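(* For all $\varepsilon',d>0$ there exist $\varepsilon,c>0$ such that for all $0<p<1$ the following holds. Let $G\subseteq\Gamma$ be graphs and let $X,Y,Z$ be (pairwise) disjoint vertex sets in $V(\Gamma)$. Assume that (1) $(X,Y)$ is $\big(p,\,c\,p^{2}\sqrt{|X||Y|}\big)$-bijumbled in $\Gamma$, (2) $(X,Z)$ is $\big(p,\,c\,p^{3}\sqrt{|X||Z|}\big)$-bijumbled in $\Gamma$, (3) $(Y,Z)$ is $\big(p,\,c\,p^{5/2}(\log_2\tfrac1p)^{-1/2}\sqrt{|Y||Z|}\big)$-bijumbled in $\Gamma$, and (4) $(Y,Z)$ is $(\varepsilon,d,p)$-regular in $G$. Then, for all but at most $\varepsilon'|X|$ vertices $x$ of $X$, the pair $\big(N_\Gamma(x)\cap Y,\,N_\Gamma(x)\cap Z\big)$ is $(\varepsilon',d,p)$-regular in $G$.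
   Context: Graphs are finite and simple. $N_\Gamma(x)$ is the neighbourhood of $x$ in $\Gamma$. For disjoint vertex sets $U,W$ in a graph, $e(U,W)$ is the number of edges between $U$ and $W$. Bijumbled: a pair $(U,V)$ of disjoint vertex sets of $\Gamma$ is $(p,\gamma)$-bijumbled in $\Gamma$ if for all $U'\subseteq U$ and $V'\subseteq V$ we have $\big|e_\Gamma(U',V')-p|U'||V'|\big|\le\gamma\sqrt{|U'||V'|}$. Sparse regularity: for $p>0$, the $p$-density of a pair $(U,W)$ of disjoint nonempty vertex sets in a graph $G$ is $d_p(U,W)=e_G(U,W)/(p|U||W|)$. The pair $(U,W)$ is $(\varepsilon,p)$-regular in $G$ if $|d_p(U',W')-d_p(U,W)|\le\varepsilon$ for all $U'\subseteq U$, $W'\subseteq W$ with $|U'|\ge\varepsilon|U|$ and $|W'|\ge\varepsilon|W|$. It is $(\varepsilon,d,p)$-regular in $G$ if moreover $d_p(U,W)\ge d-\varepsilon$. *)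

theory Defs
  imports Complex_Main "Graph_Theory.Digraph_Component"
begin

text \<open>
  A finite simple graph is a \<^locale>\<open>pair_graph\<close>: a finite loopless symmetric digraph whose arcs are
  ordered pairs, so that an undirected edge is represented by its two orientations.
\<close>

definition neighbourhood :: "'a pair_pre_digraph \<Rightarrow> 'a \<Rightarrow> 'a set" where
  "neighbourhood G x = {y. (x, y) \<in> parcs G}"

text \<open>
  For disjoint \<open>U\<close> and \<open>W\<close>, every edge between them has exactly one orientation from \<open>U\<close> to \<open>W\<close>.
\<close>

definition edges_between :: "'a pair_pre_digraph \<Rightarrow> 'a set \<Rightarrow> 'a set \<Rightarrow> nat" where
  "edges_between G U W = card (parcs G \<inter> U \<times> W)"

definition bijumbled :: "'a pair_pre_digraph \<Rightarrow> real \<Rightarrow> real \<Rightarrow> 'a set \<Rightarrow> 'a set \<Rightarrow> bool" where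
  "bijumbled G p \<gamma> U V \<longleftrightarrow>
     U \<subseteq> pverts G \<and> V \<subseteq> pverts G \<and> U \<inter> V = {} \<and>
     (\<forall>U' V'. U' \<subseteq> U \<longrightarrow> V' \<subseteq> V \<longrightarrow>
        \<bar>real (edges_between G U' V') - p * real (card U') * real (card V')\<bar>
          \<le> \<gamma> * sqrt (real (card U') * real (card V')))"

definition p_density :: "'a pair_pre_digraph \<Rightarrow> real \<Rightarrow> 'a set \<Rightarrow> 'a set \<Rightarrow> real" where
  "p_density G p U W = real (edges_between G U W) / (p * real (card U) * real (card W))"

text \<open>
  The \<open>p\<close>-density is only meaningful for disjoint nonempty vertex sets, so a regular pair
  is required to consist of such sets.
\<close>

definition regular_pair :: "'a pair_pre_digraph \<Rightarrow> real \<Rightarrow> real \<Rightarrow> 'a set \<Rightarrow> 'a set \<Rightarrow> bool" where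
  "regular_pair G \<epsilon> p U W \<longleftrightarrow>
     U \<subseteq> pverts G \<and> W \<subseteq> pverts G \<and> U \<inter> W = {} \<and> U \<noteq> {} \<and> W \<noteq> {} \<and>
     (\<forall>U' W'. U' \<subseteq> U \<longrightarrow> W' \<subseteq> W \<longrightarrow>
        real (card U') \<ge> \<epsilon> * real (card U) \<longrightarrow> real (card W') \<ge> \<epsilon> * real (card W) \<longrightarrow>
        \<bar>p_density G p U' W' - p_density G p U W\<bar> \<le> \<epsilon>)"

definition dense_regular_pair ::
    "'a pair_pre_digraph \<Rightarrow> real \<Rightarrow> real \<Rightarrow> real \<Rightarrow> 'a set \<Rightarrow> 'a set \<Rightarrow> bool" where
  "dense_regular_pair G \<epsilon> d p U W \<longleftrightarrow> regular_pair G \<epsilon> p U W \<and> p_density G p U W \<ge> d - \<epsilon>"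

end

theory Submission
  imports Defs "HOL-Analysis.Convex"
begin

text \<open>
  Write \<open>f = 1\<^sub>G - q\<close> on \<open>Y \<times> Z\<close>, where \<open>q\<close> is the edge density of \<open>G\<close> between \<open>Y\<close> and \<open>Z\<close>, and let \<open>Y\<^sub>x\<close>, \<open>Z\<^sub>x\<close> be
  the neighbourhoods of \<open>x\<close> in \<open>Y\<close> and \<open>Z\<close>.  By Cauchy-Schwarz, for \<open>U \<subseteq> Y\<^sub>x\<close> and \<open>W \<subseteq> Z\<^sub>x\<close>,
  the square of the sum of \<open>f\<close> over \<open>U \<times> W\<close> is at most \<open>|W|\<close> times the sum over \<open>y, y' \<in> Y\<^sub>x\<close> of
  \<open>\<bar>\<Sum>z\<in>Z\<^sub>x. f(y,z) f(y',z)\<bar>\<close>,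
  so the pair \<open>(Y\<^sub>x, Z\<^sub>x)\<close> is regular as soon as the right-hand double sum, the codeviation inside the
  neighbourhood of \<open>x\<close>, is small compared with \<open>p\<^sup>5 |Y|\<^sup>2 |Z|\<close>.  By Markov's inequality it suffices that
  its sum over \<open>x\<close> is small compared with \<open>p\<^sup>5 |X| |Y|\<^sup>2 |Z|\<close>.  The codeviation is linear in the set \<open>Z\<^sub>x\<close>,
  so a discrepancy bound, which controls first moments, is the right tool.

  For a fixed pair \<open>y, y'\<close> with common neighbourhood \<open>X'\<close> in \<open>X\<close>, jumbledness of \<open>(X, Z)\<close> allows replacing the
  sum over \<open>z \<in> Z\<^sub>x\<close> by \<open>p\<close> times the sum over all of \<open>Z\<close>, for \<open>x\<close> averaged over \<open>X'\<close>: \<open>f(y,z) f(y',z)\<close> is a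
  combination of indicators of the sets \<open>N\<^sub>G(y) \<inter> N\<^sub>G(y')\<close>, \<open>N\<^sub>G(y)\<close>, \<open>N\<^sub>G(y')\<close> and \<open>Z\<close>
  (\<open>jumbled_against_codeviation\<close>).  What is left is the sum over \<open>y, y'\<close> of \<open>p |X'| |codev(y, y')|\<close>, where
  \<open>codev(y, y')\<close> is the sum of \<open>f(y,z) f(y',z)\<close> over \<open>Z\<close>.  Since \<open>|X'|\<close> is of order \<open>p\<^sup>2 |X|\<close> in mean square, by
  jumbledness of \<open>(X, Y)\<close> (\<open>weighted_codegree_sum_le\<close>), it remains to see that \<open>|codev|\<close> has small sum.

  That last point (\<open>codev_abs_sum\<close>) is where regularity of \<open>(Y, Z)\<close> enters.  Let \<open>F(y', z)\<close> be the sum of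
  \<open>f(y, z)\<close> over those \<open>y\<close> that have positive codeviation with \<open>y'\<close>.  For each \<open>y'\<close>, regularity makes
  \<open>F(y', z)\<close> small compared with \<open>p |Y|\<close> for most \<open>z\<close> (\<open>row_deviation_square_sum\<close>), but the sum of \<open>|codev|\<close> is
  at most twice that of \<open>f(y', z) F(y', z)\<close>, where \<open>f\<close> is concentrated on the sparse set of edges.  Cauchy-Schwarz
  reduces the question to comparing the sum of \<open>F\<^sup>2\<close> over the edges of \<open>\<Gamma>\<close> with \<open>p\<close> times its sum over \<open>Y \<times> Z\<close>.
  Expanding the square, the difference is a sum over pairs \<open>y\<^sub>1, y\<^sub>2\<close> of the same kind as before, with \<open>Y\<close> in the
  role of \<open>X\<close>, so that \<open>jumbled_against_codeviation\<close> applies once more.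

  All of this is done for \<open>p \<le> 1/4\<close>.  For larger \<open>p\<close> the neighbourhoods \<open>Y\<^sub>x\<close>, \<open>Z\<^sub>x\<close> are a constant proportion of
  \<open>Y\<close>, \<open>Z\<close> for most \<open>x\<close>, and regularity is inherited by large subsets (\<open>small_deviation_slice\<close>).
\<close>

section \<open>Inequalities and degrees\<close>

lemma sum_mult_le_sqrt_mult_sqrt:
  fixes a b :: "'i \<Rightarrow> real"
  shows "(\<Sum>i\<in>I. a i * b i) \<le> sqrt (\<Sum>i\<in>I. (a i)\<^sup>2) * sqrt (\<Sum>i\<in>I. (b i)\<^sup>2)"
  unfolding real_sqrt_mult[symmetric]
  by (rule real_le_rsqrt) (rule Cauchy_Schwarz_ineq_sum)

lemma double_sum_mult_le_sqrt_mult_sqrt: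
  fixes a b :: "'i \<Rightarrow> 'j \<Rightarrow> real"
  shows "(\<Sum>i\<in>I. \<Sum>j\<in>J. a i j * b i j)
    \<le> sqrt (\<Sum>i\<in>I. \<Sum>j\<in>J. (a i j)\<^sup>2) * sqrt (\<Sum>i\<in>I. \<Sum>j\<in>J. (b i j)\<^sup>2)"
  using sum_mult_le_sqrt_mult_sqrt[of "\<lambda>(i, j). a i j" "\<lambda>(i, j). b i j" "I \<times> J"]
  by (simp add: sum.cartesian_product case_prod_unfold)

lemma square_sum_le:
  fixes a :: "'i \<Rightarrow> real"
  shows "(\<Sum>i\<in>I. a i)\<^sup>2 \<le> card I * (\<Sum>i\<in>I. (a i)\<^sup>2)"
  using Cauchy_Schwarz_ineq_sum[of "\<lambda>_. 1" a I] by simp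

lemma square_add_le: "(x + y)\<^sup>2 \<le> 2 * x\<^sup>2 + 2 * y\<^sup>2" for x y :: real
  using zero_le_power2[of "x - y"] by (simp add: power2_sum power2_diff)

lemma square_add4_le: "(a + b + c + d)\<^sup>2 \<le> 4 * (a\<^sup>2 + b\<^sup>2 + c\<^sup>2 + d\<^sup>2)" for a b c d :: real
  using square_add_le[of "a + b" "c + d"] square_add_le[of a b] square_add_le[of c d]
  by (simp add: add.assoc)

lemma powr_five_halves_square: "0 < p \<Longrightarrow> (p powr (5 / 2))\<^sup>2 = p ^ 5" for p :: real
  by (simp add: power2_eq_square powr_numeral flip: powr_add)

definition nbrs :: "('a \<Rightarrow> 'b \<Rightarrow> bool) \<Rightarrow> 'b set \<Rightarrow> 'a \<Rightarrow> 'b set" where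
  "nbrs R B u = {v \<in> B. R u v}"

lemma nbrs_subset: "nbrs R B u \<subseteq> B"
  by (auto simp: nbrs_def)

lemma finite_nbrs [simp]: "finite B \<Longrightarrow> finite (nbrs R B u)"
  by (simp add: nbrs_def)

lemma card_nbrs_le: "finite B \<Longrightarrow> card (nbrs R B u) \<le> card B"
  by (simp add: card_mono nbrs_subset)

lemma card_nbrs_eq_sum: "finite B \<Longrightarrow> real (card (nbrs R B u)) = (\<Sum>v\<in>B. of_bool (R u v))"
  by (simp add: nbrs_def Collect_conj_eq Int_commute)

lemma sum_nbrs: "finite B \<Longrightarrow> sum h (nbrs R B u) = (\<Sum>v\<in>B. of_bool (R u v) * h v)" for h :: "_ \<Rightarrow> real"
  by (simp add: nbrs_def Collect_conj_eq Int_commute)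

text \<open>
  This identity turns a sum of squares of column sums into a sum of codegrees or of codeviations over pairs of rows.
\<close>

lemma sum_square_sum_eq:
  fixes g :: "'a \<Rightarrow> 'b \<Rightarrow> real"
  shows "(\<Sum>v\<in>B. (\<Sum>u\<in>A. g u v)\<^sup>2) = (\<Sum>u\<in>A. \<Sum>u'\<in>A. \<Sum>v\<in>B. g u v * g u' v)"
proof -
  have "(\<Sum>v\<in>B. (\<Sum>u\<in>A. g u v)\<^sup>2) = (\<Sum>v\<in>B. \<Sum>u\<in>A. \<Sum>u'\<in>A. g u v * g u' v)"
    by (simp only: power2_eq_square sum_product)
  also have "\<dots> = (\<Sum>u\<in>A. \<Sum>v\<in>B. \<Sum>u'\<in>A. g u v * g u' v)"
    by (rule sum.swap)
  also have "\<dots> = (\<Sum>u\<in>A. \<Sum>u'\<in>A. \<Sum>v\<in>B. g u v * g u' v)"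
    by (intro sum.cong refl sum.swap)
  finally show ?thesis .
qed

lemma sum_codegree_eq_sum_degree_square:
  assumes "finite A" "finite B"
  shows "(\<Sum>u\<in>A. \<Sum>u'\<in>A. real (card (nbrs R (nbrs R B u) u')))
       = (\<Sum>v\<in>B. (real (card (nbrs (\<lambda>v u. R u v) A v)))\<^sup>2)"
  by (simp only: card_nbrs_eq_sum sum_nbrs finite_nbrs assms sum_square_sum_eq)

text \<open>
  How jumbledness bounds a set of atypical vertices: if \<open>a\<close> vertices each deviate by \<open>s b\<close> on a set of size \<open>b\<close>,
  then \<open>s a b \<le> \<gamma> \<surd>(a b)\<close>, which bounds \<open>a\<close>.
\<close>

lemma square_mult_le_of_le_sqrt:
  fixes s a b \<gamma> :: real
  assumes "s * (a * b) \<le> \<gamma> * sqrt (a * b)" "s \<ge> 0" "a \<ge> 0" "b \<ge> 0"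
  shows "s\<^sup>2 * b * a \<le> \<gamma>\<^sup>2"
proof (cases "a * b = 0")
  case True
  then show ?thesis by auto
next
  case False
  then have pos: "a * b > 0" using assms by (simp add: less_le)
  have "(s * (a * b))\<^sup>2 \<le> (\<gamma> * sqrt (a * b))\<^sup>2"
    using assms by (intro power_mono) auto
  then have "s\<^sup>2 * b * a * (a * b) \<le> \<gamma>\<^sup>2 * (a * b)"
    using pos by (simp add: power_mult_distrib power2_eq_square mult_ac)
  then show ?thesis using pos by (rule mult_right_le_imp_le)
qed

section \<open>Degrees and codegrees in jumbled pairs\<close>

text \<open>
  Bijumbledness in the form in which it is used: a discrepancy bound for the centred indicator of the relation.
  The two sides may have different types, so that one statement serves all three pairs among \<open>X\<close>, \<open>Y\<close>, \<open>Z\<close> in both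
  directions.
\<close>

locale jumbled_pair =
  fixes R :: "'a \<Rightarrow> 'b \<Rightarrow> bool" and p \<gamma> :: real and U :: "'a set" and V :: "'b set"
  assumes finite_U: "finite U" and finite_V: "finite V"
    and p_pos: "0 < p" and \<gamma>_nonneg: "0 \<le> \<gamma>"
    and discrepancy: "\<And>A B. A \<subseteq> U \<Longrightarrow> B \<subseteq> V \<Longrightarrow>
      \<bar>\<Sum>u\<in>A. \<Sum>v\<in>B. of_bool (R u v) - p\<bar> \<le> \<gamma> * sqrt (real (card A) * real (card B))"
begin

lemma transposed: "jumbled_pair (\<lambda>v u. R u v) p \<gamma> V U"
proof
  fix A B assume "A \<subseteq> V" "B \<subseteq> U"
  then show "\<bar>\<Sum>u\<in>A. \<Sum>v\<in>B. of_bool (R v u) - p\<bar> \<le> \<gamma> * sqrt (real (card A) * real (card B))"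
    using discrepancy[of B A] by (subst sum.swap) (simp add: mult.commute)
qed (use finite_U finite_V p_pos \<gamma>_nonneg in auto)

lemma sum_eq_degree: "B \<subseteq> V \<Longrightarrow> (\<Sum>v\<in>B. of_bool (R u v) - p) = real (card (nbrs R B u)) - p * card B"
  by (subst card_nbrs_eq_sum) (auto simp: sum_subtractf intro: finite_subset[OF _ finite_V])

text \<open>
  The rows on which the deviation is positive and those on which it is negative each form a set to which the
  discrepancy bound applies.
\<close>

lemma row_discrepancy:
  assumes "A \<subseteq> U" "B \<subseteq> V"
  shows "(\<Sum>u\<in>A. \<bar>\<Sum>v\<in>B. of_bool (R u v) - p\<bar>) \<le> 2 * \<gamma> * sqrt (card A) * sqrt (card B)"
proof -
  have finA: "finite A" using assms finite_U finite_subset by blast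
  define D where "D u = (\<Sum>v\<in>B. of_bool (R u v) - p)" for u
  define P where "P = {u \<in> A. D u \<ge> 0}"
  define N where "N = A - P"
  have part: "\<bar>sum D C\<bar> \<le> \<gamma> * sqrt (card A) * sqrt (card B)" if "C \<subseteq> A" for C
  proof -
    have "\<bar>sum D C\<bar> \<le> \<gamma> * sqrt (real (card C) * real (card B))"
      unfolding D_def using that assms by (intro discrepancy) auto
    also have "\<dots> \<le> \<gamma> * sqrt (real (card A) * real (card B))"
      using that finA \<gamma>_nonneg by (intro mult_left_mono real_sqrt_le_mono mult_right_mono) (auto intro: card_mono)
    finally show ?thesis by (simp add: real_sqrt_mult)
  qed
  have "(\<Sum>u\<in>A. \<bar>D u\<bar>) = (\<Sum>u\<in>P. \<bar>D u\<bar>) + (\<Sum>u\<in>N. \<bar>D u\<bar>)"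
    using finA sum.subset_diff[of P A "\<lambda>u. \<bar>D u\<bar>"] by (simp add: N_def P_def)
  also have "(\<Sum>u\<in>P. \<bar>D u\<bar>) = sum D P"
    by (intro sum.cong) (auto simp: P_def)
  also have "(\<Sum>u\<in>N. \<bar>D u\<bar>) = - sum D N"
    unfolding sum_negf[symmetric] by (intro sum.cong) (auto simp: N_def P_def)
  also have "sum D P + - sum D N \<le> 2 * \<gamma> * sqrt (card A) * sqrt (card B)"
    using part[of P] part[of N] by (auto simp: P_def N_def)
  finally show ?thesis by (simp add: D_def)
qed

lemma card_high_degree:
  assumes "A \<subseteq> U" "B \<subseteq> V" and t: "2 * p \<le> t"
  shows "t\<^sup>2 * card B * card {u \<in> A. t * card B < card (nbrs R B u)} \<le> 4 * \<gamma>\<^sup>2"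
proof -
  define A' where "A' = {u \<in> A. t * card B < card (nbrs R B u)}"
  have "t / 2 * (real (card A') * card B) = (\<Sum>u\<in>A'. t / 2 * card B)" by simp
  also have "\<dots> \<le> (\<Sum>u\<in>A'. \<Sum>v\<in>B. of_bool (R u v) - p)"
  proof (rule sum_mono)
    fix u assume u: "u \<in> A'"
    have "p * card B \<le> t / 2 * card B" using t by (intro mult_right_mono) auto
    moreover have "t * card B < card (nbrs R B u)" using u by (simp add: A'_def)
    ultimately show "t / 2 * card B \<le> (\<Sum>v\<in>B. of_bool (R u v) - p)"
      unfolding sum_eq_degree[OF assms(2)] by (simp add: field_simps)
  qed
  also have "\<dots> \<le> \<gamma> * sqrt (real (card A') * card B)"
    using order_trans[OF abs_ge_self discrepancy[of A' B]] assms by (auto simp: A'_def)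
  finally have "(t / 2)\<^sup>2 * card B * card A' \<le> \<gamma>\<^sup>2"
    using t p_pos by (intro square_mult_le_of_le_sqrt) auto
  then show ?thesis by (simp add: A'_def power_divide)
qed

lemma card_low_degree:
  shows "p\<^sup>2 * card V * card {u \<in> U. card (nbrs R V u) < p / 2 * card V} \<le> 4 * \<gamma>\<^sup>2"
proof -
  define A where "A = {u \<in> U. card (nbrs R V u) < p / 2 * card V}"
  have "p / 2 * (real (card A) * card V) = (\<Sum>u\<in>A. p / 2 * card V)" by simp
  also have "\<dots> \<le> (\<Sum>u\<in>A. - (\<Sum>v\<in>V. of_bool (R u v) - p))"
  proof (rule sum_mono)
    fix u assume "u \<in> A"
    then show "p / 2 * card V \<le> - (\<Sum>v\<in>V. of_bool (R u v) - p)"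
      unfolding sum_eq_degree[OF subset_refl] by (simp add: A_def)
  qed
  also have "\<dots> \<le> \<gamma> * sqrt (real (card A) * card V)"
    using discrepancy[of A V] by (auto simp: A_def sum_negf)
  finally have "(p / 2)\<^sup>2 * card V * card A \<le> \<gamma>\<^sup>2"
    using p_pos by (intro square_mult_le_of_le_sqrt) auto
  then show ?thesis by (simp add: A_def power_divide)
qed

lemma card_low_degree_le:
  fixes c :: real
  assumes "V \<noteq> {}" and \<gamma>: "\<gamma> \<le> c * p * sqrt (real (card U) * real (card V))"
  shows "card {u \<in> U. card (nbrs R V u) < p / 2 * card V} \<le> 4 * c\<^sup>2 * card U"
proof -
  define k where "k = real (card {u \<in> U. card (nbrs R V u) < p / 2 * card V})"
  have V: "real (card V) > 0" using assms finite_V by (simp add: card_gt_0_iff)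
  have "\<gamma>\<^sup>2 \<le> (c * p * sqrt (real (card U) * real (card V)))\<^sup>2"
    using \<gamma> \<gamma>_nonneg by (rule power_mono)
  then have "p\<^sup>2 * card V * k \<le> 4 * (c\<^sup>2 * p\<^sup>2 * (card U * card V))"
    using card_low_degree unfolding k_def by (simp add: power_mult_distrib)
  then have "p\<^sup>2 * card V * k \<le> p\<^sup>2 * card V * (4 * c\<^sup>2 * card U)" by (simp add: mult_ac)
  moreover have "0 < p\<^sup>2 * card V" using p_pos V by simp
  ultimately have "k \<le> 4 * c\<^sup>2 * card U" by (rule mult_left_le_imp_le)
  then show ?thesis by (simp only: k_def)
qed

text \<open>
  Vertices whose degree into \<open>B\<close> exceeds twice its expected value contribute little to the second moment.
  The number of vertices of degree above \<open>t |B|\<close> is of order \<open>\<gamma>\<^sup>2 / (t\<^sup>2 |B|)\<close>.  Summing this over all dyadic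
  \<open>t\<close> would give \<open>\<gamma>\<^sup>2 |B| log (1/p)\<close>; the two thresholds \<open>t = 2 p\<close> and \<open>t = \<surd>p\<close> give the bound with \<open>1/p\<close> for
  the logarithm, which is strong enough below.
\<close>

lemma high_degree_square_sum:
  assumes "p \<le> 1/4" "A \<subseteq> U" "B \<subseteq> V"
  shows "(\<Sum>u\<in>{u \<in> A. 2 * p * card B < card (nbrs R B u)}. (real (card (nbrs R B u)))\<^sup>2) \<le> 5 * \<gamma>\<^sup>2 * card B / p"
proof -
  have finA: "finite A" and finB: "finite B" using assms finite_U finite_V finite_subset by auto
  define b where "b = real (card B)"
  define d where "d u = real (card (nbrs R B u))" for u
  define M where "M = {u \<in> A. 2 * p * b < d u}"
  \<comment> \<open>On M the square of the degree is at most p b^2 outside H, and at most b^2 on H.\<close>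
  define H where "H = {u \<in> A. sqrt p * b < d u}"
  have b0: "b \<ge> 0" by (simp add: b_def)
  have sq: "2 * p \<le> sqrt p"
    using assms p_pos by (intro real_le_rsqrt) (simp add: power2_eq_square)
  have "2 * p * b \<le> sqrt p * b" using sq b0 by (rule mult_right_mono)
  then have HM: "H \<subseteq> M" by (auto simp: H_def M_def)
  have finM: "finite M" using finA by (simp add: M_def)
  have pointwise: "(d u)\<^sup>2 \<le> p * b\<^sup>2 + (if u \<in> H then b\<^sup>2 else 0)" if "u \<in> M" for u
  proof (cases "u \<in> H")
    case True
    have "(d u)\<^sup>2 \<le> b\<^sup>2"
      using card_nbrs_le[OF finB, of R u] by (intro power_mono) (auto simp: d_def b_def)
    with True p_pos b0 show ?thesis by (auto intro: add_increasing)
  next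
    case False
    then have "(d u)\<^sup>2 \<le> (sqrt p * b)\<^sup>2"
      using that by (intro power_mono) (auto simp: H_def M_def d_def)
    with False p_pos show ?thesis by (simp add: power_mult_distrib)
  qed
  have "(\<Sum>u\<in>M. (d u)\<^sup>2) \<le> (\<Sum>u\<in>M. p * b\<^sup>2 + (if u \<in> H then b\<^sup>2 else 0))"
    by (rule sum_mono) (rule pointwise)
  also have "\<dots> = card M * (p * b\<^sup>2) + card H * b\<^sup>2"
    using HM finM by (simp add: sum.distrib sum.If_cases Int_absorb1)
  also have "card M * (p * b\<^sup>2) \<le> \<gamma>\<^sup>2 * b / p"
  proof -
    have "(2 * p)\<^sup>2 * b * card M \<le> 4 * \<gamma>\<^sup>2"
      using card_high_degree[of A B "2 * p"] assms by (simp add: b_def M_def d_def)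
    then have "(p\<^sup>2 * b * card M) * b \<le> \<gamma>\<^sup>2 * b" using b0 by (intro mult_right_mono) auto
    then show ?thesis using p_pos by (simp add: field_simps power2_eq_square)
  qed
  also have "card H * b\<^sup>2 \<le> 4 * \<gamma>\<^sup>2 * b / p"
  proof -
    have "(sqrt p)\<^sup>2 * b * card H \<le> 4 * \<gamma>\<^sup>2"
      using card_high_degree[of A B "sqrt p"] assms sq by (simp only: b_def H_def d_def)
    then have "(p * b * card H) * b \<le> 4 * \<gamma>\<^sup>2 * b" using b0 p_pos by (intro mult_right_mono) auto
    then show ?thesis using p_pos by (simp add: field_simps power2_eq_square)
  qed
  finally have "(\<Sum>u\<in>M. (d u)\<^sup>2) \<le> 5 * \<gamma>\<^sup>2 * b / p"
    by (simp add: add_divide_distrib[symmetric] mult_ac)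
  then show ?thesis unfolding d_def b_def M_def .
qed

lemma degree_square_sum:
  assumes "p \<le> 1/4" "A \<subseteq> U" "B \<subseteq> V"
  shows "(\<Sum>u\<in>A. (real (card (nbrs R B u)))\<^sup>2) \<le> 4 * p\<^sup>2 * (card B)\<^sup>2 * card A + 5 * \<gamma>\<^sup>2 * card B / p"
proof -
  have finA: "finite A" using assms finite_U finite_subset by auto
  define d where "d u = real (card (nbrs R B u))" for u
  define M where "M = {u \<in> A. 2 * p * card B < d u}"
  have "(\<Sum>u\<in>A. (d u)\<^sup>2) = (\<Sum>u\<in>A - M. (d u)\<^sup>2) + (\<Sum>u\<in>M. (d u)\<^sup>2)"
    using finA by (intro sum.subset_diff) (auto simp: M_def)
  also have "(\<Sum>u\<in>A - M. (d u)\<^sup>2) \<le> (\<Sum>u\<in>A - M. (2 * p * card B)\<^sup>2)"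
    by (intro sum_mono power_mono) (auto simp: M_def d_def)
  also have "\<dots> \<le> (\<Sum>u\<in>A. (2 * p * card B)\<^sup>2)"
    using finA by (intro sum_mono2) auto
  also have "(\<Sum>u\<in>M. (d u)\<^sup>2) \<le> 5 * \<gamma>\<^sup>2 * card B / p"
    using high_degree_square_sum[OF assms] by (simp add: M_def d_def)
  finally show ?thesis by (simp add: d_def power_mult_distrib mult_ac)
qed

lemma degree_sum: "(\<Sum>u\<in>U. real (card (nbrs R V u))) \<le> p * card U * card V + \<gamma> * sqrt (real (card U) * real (card V))"
proof -
  have "(\<Sum>u\<in>U. \<Sum>v\<in>V. of_bool (R u v) - p) = (\<Sum>u\<in>U. real (card (nbrs R V u)) - p * card V)"
    by (simp only: sum_eq_degree[OF subset_refl])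
  also have "\<dots> = (\<Sum>u\<in>U. real (card (nbrs R V u))) - p * card U * card V"
    by (simp add: sum_subtractf)
  finally have "(\<Sum>u\<in>U. \<Sum>v\<in>V. of_bool (R u v) - p) = \<dots>" .
  then show ?thesis using discrepancy[of U V] by simp
qed

end

text \<open>
  The bound on \<open>\<gamma>\<close> gives the first two moments of the degrees and codegrees, up to constants, the values that they
  have in a random graph of density \<open>p\<close>.  The codegree moment is what determines the exponent of \<open>p\<close>.
\<close>

locale strongly_jumbled_pair = jumbled_pair +
  assumes p_le: "p \<le> 1/4" and \<gamma>_le: "\<gamma>\<^sup>2 \<le> p ^ 4 * card U * card V"
begin

lemma transposed_strong: "strongly_jumbled_pair (\<lambda>v u. R u v) p \<gamma> V U"
  using p_le \<gamma>_le
  by (intro strongly_jumbled_pair.intro strongly_jumbled_pair_axioms.intro transposed) (simp_all add: mult_ac)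

lemma degree_sum_le: "(\<Sum>u\<in>U. real (card (nbrs R V u))) \<le> 2 * p * card U * card V"
proof -
  define k where "k = real (card U) * card V"
  have k0: "k \<ge> 0" by (simp add: k_def)
  have "\<gamma>\<^sup>2 \<le> p\<^sup>2 * k"
  proof -
    have "p ^ 4 * k \<le> p\<^sup>2 * k"
      using p_le p_pos k0 by (intro mult_right_mono power_decreasing) auto
    then show ?thesis using \<gamma>_le by (simp add: k_def mult.assoc)
  qed
  then have "\<gamma> \<le> p * sqrt k"
    using real_le_rsqrt[of \<gamma> "p\<^sup>2 * k"] p_pos by (simp add: real_sqrt_mult)
  then have "\<gamma> * sqrt k \<le> p * sqrt k * sqrt k" using k0 by (intro mult_right_mono) auto
  then have "\<gamma> * sqrt k \<le> p * k" using k0 by (simp add: mult.assoc)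
  then show ?thesis using degree_sum by (simp add: k_def mult.assoc)
qed

lemma degree_square_sum_le: "(\<Sum>u\<in>U. (real (card (nbrs R V u)))\<^sup>2) \<le> 9 * p\<^sup>2 * card U * (card V)\<^sup>2"
proof -
  define u v where "u = real (card U)" and "v = real (card V)"
  have nn: "u \<ge> 0" "v \<ge> 0" by (simp_all add: u_def v_def)
  have "\<gamma>\<^sup>2 * v / p \<le> p ^ 4 * u * v * v / p"
    using \<gamma>_le nn p_pos by (intro divide_right_mono mult_right_mono) (auto simp: u_def v_def)
  also have "\<dots> = p ^ 3 * (u * v\<^sup>2)" using p_pos by (simp add: field_simps power2_eq_square eval_nat_numeral)
  also have "\<dots> \<le> p\<^sup>2 * (u * v\<^sup>2)"
    using nn p_pos p_le by (intro mult_right_mono power_decreasing) auto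
  finally have "5 * \<gamma>\<^sup>2 * v / p \<le> 5 * p\<^sup>2 * u * v\<^sup>2" by simp
  then show ?thesis
    using degree_square_sum[OF p_le subset_refl subset_refl] by (simp add: u_def v_def mult_ac)
qed

lemma codegree_sum_le:
  "(\<Sum>u\<in>U. \<Sum>u'\<in>U. real (card (nbrs R (nbrs R V u) u'))) \<le> 9 * p\<^sup>2 * (card U)\<^sup>2 * card V"
proof -
  interpret T: strongly_jumbled_pair "\<lambda>v u. R u v" p \<gamma> V U by (rule transposed_strong)
  show ?thesis
    using T.degree_square_sum_le
    by (simp only: sum_codegree_eq_sum_degree_square finite_U finite_V mult_ac)
qed

lemma codegree_square_sum_le:
  "(\<Sum>u\<in>U. \<Sum>u'\<in>U. (real (card (nbrs R (nbrs R V u) u')))\<^sup>2) \<le> 46 * p ^ 4 * (card U)\<^sup>2 * (card V)\<^sup>2"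
proof -
  define n m where "n = real (card U)" and "m = real (card V)"
  define d where "d u = real (card (nbrs R V u))" for u
  have nn: "n \<ge> 0" "m \<ge> 0" by (simp_all add: n_def m_def)
  have "(\<Sum>u\<in>U. \<Sum>u'\<in>U. (real (card (nbrs R (nbrs R V u) u')))\<^sup>2)
      \<le> (\<Sum>u\<in>U. 4 * p\<^sup>2 * n * (d u)\<^sup>2 + 5 * \<gamma>\<^sup>2 / p * d u)"
    using degree_square_sum[OF p_le subset_refl nbrs_subset[of R V]]
    by (intro sum_mono) (simp add: n_def d_def mult_ac)
  also have "\<dots> = 4 * p\<^sup>2 * n * (\<Sum>u\<in>U. (d u)\<^sup>2) + 5 * \<gamma>\<^sup>2 / p * (\<Sum>u\<in>U. d u)"
    by (simp only: sum.distrib sum_distrib_left)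
  also have "\<dots> \<le> 4 * p\<^sup>2 * n * (9 * p\<^sup>2 * n * m\<^sup>2) + 5 * \<gamma>\<^sup>2 / p * (2 * p * n * m)"
    using degree_square_sum_le degree_sum_le nn p_pos
    by (intro add_mono mult_left_mono) (auto simp: d_def n_def m_def)
  also have "\<dots> = 36 * p ^ 4 * n\<^sup>2 * m\<^sup>2 + 10 * (\<gamma>\<^sup>2 * (n * m))"
    using p_pos by (simp add: field_simps power2_eq_square eval_nat_numeral)
  also have "\<gamma>\<^sup>2 * (n * m) \<le> p ^ 4 * n * m * (n * m)"
    using \<gamma>_le nn by (intro mult_right_mono) (auto simp: n_def m_def)
  finally show ?thesis by (simp add: n_def m_def power2_eq_square mult_ac)
qed

text \<open>
  Up to an excess that is small in mean square, every codegree is at most \<open>4 p\<^sup>2 |V|\<close>.  A codegree can be larger only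
  because \<open>u\<close> has a large degree (\<open>E1\<close>) or because \<open>u'\<close> has many neighbours among those of \<open>u\<close> (\<open>E2\<close>), and both are
  controlled by the second moment of high degrees.
\<close>

lemma weighted_codegree_sum_le:
  fixes w :: "'a \<Rightarrow> 'a \<Rightarrow> real"
  assumes w: "\<And>u u'. w u u' \<ge> 0"
  shows "(\<Sum>u\<in>U. \<Sum>u'\<in>U. real (card (nbrs R (nbrs R V u) u')) * w u u')
    \<le> 4 * p\<^sup>2 * card V * (\<Sum>u\<in>U. \<Sum>u'\<in>U. w u u')
      + sqrt (30 * \<gamma>\<^sup>2 * card U * card V) * sqrt (\<Sum>u\<in>U. \<Sum>u'\<in>U. (w u u')\<^sup>2)"
proof -
  define n m where "n = real (card U)" and "m = real (card V)"
  define d where "d u = real (card (nbrs R V u))" for u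
  define c where "c u u' = real (card (nbrs R (nbrs R V u) u'))" for u u'
  define E1 where "E1 u = (if 2 * p * m < d u then 2 * p * d u else 0)" for u
  define E2 where "E2 u u' = (if 2 * p * d u < c u u' then c u u' else 0)" for u u'
  have nn: "n \<ge> 0" "m \<ge> 0" "\<And>u. d u \<ge> 0" "\<And>u u'. c u u' \<ge> 0"
    by (simp_all add: n_def m_def d_def c_def)
  have c_le: "c u u' \<le> 4 * p\<^sup>2 * m + (E1 u + E2 u u')" for u u'
  proof -
    have a: "c u u' \<le> 2 * p * d u + E2 u u'" using nn p_pos by (simp add: E2_def)
    have "2 * p * d u \<le> 4 * p\<^sup>2 * m + E1 u"
    proof (cases "2 * p * m < d u")
      case True
      then show ?thesis using nn by (simp add: E1_def)
    next
      case False
      then have "2 * p * d u \<le> 2 * p * (2 * p * m)" using p_pos by (intro mult_left_mono) auto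
      with False show ?thesis by (simp add: E1_def power2_eq_square)
    qed
    with a show ?thesis by simp
  qed
  have E1_sum: "(\<Sum>u\<in>U. (E1 u)\<^sup>2) \<le> 20 * p * \<gamma>\<^sup>2 * m"
  proof -
    have "(\<Sum>u\<in>U. (E1 u)\<^sup>2) = (\<Sum>u\<in>U. if 2 * p * m < d u then 4 * p\<^sup>2 * (d u)\<^sup>2 else 0)"
      by (intro sum.cong) (auto simp: E1_def power_mult_distrib)
    also have "\<dots> = 4 * p\<^sup>2 * (\<Sum>u\<in>{u \<in> U. 2 * p * m < d u}. (d u)\<^sup>2)"
      by (simp add: sum.inter_filter[OF finite_U, symmetric] sum_distrib_left)
    also have "\<dots> \<le> 4 * p\<^sup>2 * (5 * \<gamma>\<^sup>2 * m / p)"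
      using high_degree_square_sum[OF p_le subset_refl subset_refl]
      by (intro mult_left_mono) (auto simp only: d_def m_def zero_le_power2 zero_le_mult_iff)
    also have "\<dots> = 20 * p * \<gamma>\<^sup>2 * m" using p_pos by (simp add: power2_eq_square)
    finally show ?thesis .
  qed
  have E2_sum: "(\<Sum>u'\<in>U. (E2 u u')\<^sup>2) \<le> 5 * \<gamma>\<^sup>2 / p * d u" for u
  proof -
    have "(\<Sum>u'\<in>U. (E2 u u')\<^sup>2) = (\<Sum>u'\<in>U. if 2 * p * d u < c u u' then (c u u')\<^sup>2 else 0)"
      by (intro sum.cong) (auto simp: E2_def)
    also have "\<dots> = (\<Sum>u'\<in>{u' \<in> U. 2 * p * d u < c u u'}. (c u u')\<^sup>2)"
      by (simp add: sum.inter_filter[OF finite_U, symmetric])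
    also have "\<dots> \<le> 5 * \<gamma>\<^sup>2 * d u / p"
      using high_degree_square_sum[OF p_le subset_refl nbrs_subset] by (simp only: d_def c_def)
    finally show ?thesis by simp
  qed
  have "(\<Sum>u\<in>U. \<Sum>u'\<in>U. (E1 u + E2 u u')\<^sup>2) \<le> (\<Sum>u\<in>U. \<Sum>u'\<in>U. 2 * (E1 u)\<^sup>2 + 2 * (E2 u u')\<^sup>2)"
    by (intro sum_mono square_add_le)
  also have "\<dots> = 2 * n * (\<Sum>u\<in>U. (E1 u)\<^sup>2) + 2 * (\<Sum>u\<in>U. \<Sum>u'\<in>U. (E2 u u')\<^sup>2)"
    by (simp add: sum.distrib sum_distrib_left n_def mult_ac)
  also have "\<dots> \<le> 2 * n * (20 * p * \<gamma>\<^sup>2 * m) + 2 * (\<Sum>u\<in>U. 5 * \<gamma>\<^sup>2 / p * d u)"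
    using E1_sum E2_sum nn by (intro add_mono mult_left_mono sum_mono) auto
  also have "(\<Sum>u\<in>U. 5 * \<gamma>\<^sup>2 / p * d u) = 5 * \<gamma>\<^sup>2 / p * (\<Sum>u\<in>U. d u)"
    by (simp only: sum_distrib_left)
  also have "\<dots> \<le> 5 * \<gamma>\<^sup>2 / p * (2 * p * n * m)"
    using degree_sum_le p_pos by (intro mult_left_mono) (auto simp: d_def n_def m_def)
  also have "2 * n * (20 * p * \<gamma>\<^sup>2 * m) + 2 * (5 * \<gamma>\<^sup>2 / p * (2 * p * n * m)) = (40 * p + 20) * (\<gamma>\<^sup>2 * n * m)"
    using p_pos by (simp add: field_simps)
  also have "\<dots> \<le> 30 * (\<gamma>\<^sup>2 * n * m)"
    using p_le nn by (intro mult_right_mono) auto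
  finally have E_sum: "(\<Sum>u\<in>U. \<Sum>u'\<in>U. (E1 u + E2 u u')\<^sup>2) \<le> 30 * \<gamma>\<^sup>2 * n * m" by (simp add: mult_ac)
  have "(\<Sum>u\<in>U. \<Sum>u'\<in>U. c u u' * w u u')
      \<le> (\<Sum>u\<in>U. \<Sum>u'\<in>U. 4 * p\<^sup>2 * m * w u u' + (E1 u + E2 u u') * w u u')"
    unfolding distrib_right[symmetric] by (intro sum_mono mult_right_mono c_le w)
  also have "\<dots> = 4 * p\<^sup>2 * m * (\<Sum>u\<in>U. \<Sum>u'\<in>U. w u u') + (\<Sum>u\<in>U. \<Sum>u'\<in>U. (E1 u + E2 u u') * w u u')"
    by (simp only: sum.distrib sum_distrib_left)
  also have "(\<Sum>u\<in>U. \<Sum>u'\<in>U. (E1 u + E2 u u') * w u u')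
      \<le> sqrt (\<Sum>u\<in>U. \<Sum>u'\<in>U. (E1 u + E2 u u')\<^sup>2) * sqrt (\<Sum>u\<in>U. \<Sum>u'\<in>U. (w u u')\<^sup>2)"
    by (rule double_sum_mult_le_sqrt_mult_sqrt)
  also have "\<dots> \<le> sqrt (30 * \<gamma>\<^sup>2 * n * m) * sqrt (\<Sum>u\<in>U. \<Sum>u'\<in>U. (w u u')\<^sup>2)"
    using E_sum by (intro mult_right_mono real_sqrt_le_mono) (auto intro!: sum_nonneg)
  finally show ?thesis by (simp add: c_def n_def m_def)
qed

end

section \<open>Codeviation in a subgraph of a jumbled pair\<close>

text \<open>
  The parameter \<open>q\<close> is meant to be the edge density of \<open>G\<close>, but only its order of magnitude matters until regularity
  is used.
\<close>

locale jumbled_subgraph = strongly_jumbled_pair E p \<gamma> Y Z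
  for E :: "'b \<Rightarrow> 'c \<Rightarrow> bool" and p \<gamma> :: real and Y :: "'b set" and Z :: "'c set" +
  fixes G :: "'b \<Rightarrow> 'c \<Rightarrow> bool" and q :: real
  assumes G_sub: "\<And>y z. y \<in> Y \<Longrightarrow> z \<in> Z \<Longrightarrow> G y z \<Longrightarrow> E y z"
    and q_nonneg: "0 \<le> q" and q_le: "q \<le> 2 * p"
begin

definition dev :: "'b \<Rightarrow> 'c \<Rightarrow> real" where
  "dev y z = of_bool (G y z) - q"

definition codev :: "'b \<Rightarrow> 'b \<Rightarrow> real" where
  "codev y y' = (\<Sum>z\<in>Z. dev y z * dev y' z)"

definition deg :: "'b \<Rightarrow> real" where
  "deg y = card (nbrs E Z y)"

definition codeg :: "'b \<Rightarrow> 'b \<Rightarrow> real" where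
  "codeg y y' = card (nbrs E (nbrs E Z y) y')"

text \<open>
  The error made when \<open>jumbled_against_codeviation\<close> is applied to the pair \<open>y, y'\<close>: the terms belong to the four
  products in the expansion of \<open>dev y z * dev y' z\<close>.
\<close>

definition wt :: "'b \<Rightarrow> 'b \<Rightarrow> real" where
  "wt y y' = sqrt (codeg y y') + q * sqrt (deg y) + q * sqrt (deg y') + q\<^sup>2 * sqrt (card Z)"

lemma deg_nonneg [simp]: "0 \<le> deg y" by (simp add: deg_def)
lemma codeg_nonneg [simp]: "0 \<le> codeg y y'" by (simp add: codeg_def)
lemma wt_nonneg [simp]: "0 \<le> wt y y'" using q_nonneg by (simp add: wt_def)

lemma q_power_le: "q\<^sup>2 \<le> 4 * p\<^sup>2" "q ^ 4 \<le> 16 * p ^ 4"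
  using power_mono[OF q_le q_nonneg, of 2] power_mono[OF q_le q_nonneg, of 4]
  by (simp_all add: power_mult_distrib)

lemma p_power_le: "p ^ 3 \<le> p\<^sup>2 / 4" "p ^ 4 \<le> p\<^sup>2 / 16"
proof -
  have "p ^ 3 = p\<^sup>2 * p" "p ^ 4 = p\<^sup>2 * p\<^sup>2" by (simp_all add: eval_nat_numeral)
  moreover have "p\<^sup>2 \<le> (1/4)\<^sup>2" using p_le p_pos by (intro power_mono) auto
  ultimately show "p ^ 3 \<le> p\<^sup>2 / 4" "p ^ 4 \<le> p\<^sup>2 / 16"
    using p_le mult_left_mono[OF p_le, of "p\<^sup>2"] mult_left_mono[of "p\<^sup>2" "(1/4)\<^sup>2" "p\<^sup>2"]
    by (simp_all add: power_divide)
qed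

lemma abs_dev_le: "y \<in> Y \<Longrightarrow> z \<in> Z \<Longrightarrow> \<bar>dev y z\<bar> \<le> of_bool (E y z) + q"
  using G_sub[of y z] q_nonneg q_le p_le by (auto simp: dev_def)

lemma wt_square_sum: "(\<Sum>y\<in>Y. \<Sum>y'\<in>Y. (wt y y')\<^sup>2) \<le> 56 * p\<^sup>2 * (card Y)\<^sup>2 * card Z"
proof -
  define n m where "n = real (card Y)" and "m = real (card Z)"
  have nn: "n \<ge> 0" "m \<ge> 0" by (simp_all add: n_def m_def)
  have "(\<Sum>y\<in>Y. \<Sum>y'\<in>Y. (wt y y')\<^sup>2)
      \<le> (\<Sum>y\<in>Y. \<Sum>y'\<in>Y. 4 * (codeg y y' + q\<^sup>2 * deg y + q\<^sup>2 * deg y' + q ^ 4 * m))"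
  proof (intro sum_mono)
    fix y y'
    show "(wt y y')\<^sup>2 \<le> 4 * (codeg y y' + q\<^sup>2 * deg y + q\<^sup>2 * deg y' + q ^ 4 * m)"
      using square_add4_le[of "sqrt (codeg y y')" "q * sqrt (deg y)" "q * sqrt (deg y')" "q\<^sup>2 * sqrt (card Z)"]
      by (simp add: wt_def power_mult_distrib m_def flip: power_mult)
  qed
  also have "\<dots> = 4 * ((\<Sum>y\<in>Y. \<Sum>y'\<in>Y. codeg y y') + 2 * q\<^sup>2 * n * (\<Sum>y\<in>Y. deg y) + q ^ 4 * n\<^sup>2 * m)"
    by (simp add: sum.distrib sum_distrib_left n_def power2_eq_square mult_ac)
  also have "\<dots> \<le> 4 * (9 * p\<^sup>2 * n\<^sup>2 * m + 2 * (4 * p\<^sup>2) * n * (2 * p * n * m) + 16 * p ^ 4 * n\<^sup>2 * m)"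
    using codegree_sum_le degree_sum_le q_power_le nn q_nonneg p_pos
    by (intro mult_left_mono add_mono mult_mono)
       (auto simp: n_def m_def deg_def codeg_def intro!: sum_nonneg)
  also have "\<dots> = (36 * p\<^sup>2 + 64 * p ^ 3 + 64 * p ^ 4) * (n\<^sup>2 * m)"
    by (simp add: field_simps eval_nat_numeral)
  also have "\<dots> \<le> 56 * p\<^sup>2 * (n\<^sup>2 * m)"
    using p_power_le nn by (intro mult_right_mono) auto
  finally show ?thesis by (simp add: n_def m_def mult.assoc)
qed

lemma codev_square_sum: "(\<Sum>y\<in>Y. \<Sum>y'\<in>Y. (codev y y')\<^sup>2) \<le> 536 * p ^ 4 * (card Y)\<^sup>2 * (card Z)\<^sup>2"
proof -
  define n m where "n = real (card Y)" and "m = real (card Z)"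
  have nn: "n \<ge> 0" "m \<ge> 0" by (simp_all add: n_def m_def)
  have abs_codev: "\<bar>codev y y'\<bar> \<le> codeg y y' + q * deg y + q * deg y' + q\<^sup>2 * m"
    if "y \<in> Y" "y' \<in> Y" for y y'
  proof -
    have "\<bar>codev y y'\<bar> \<le> (\<Sum>z\<in>Z. \<bar>dev y z\<bar> * \<bar>dev y' z\<bar>)"
      unfolding codev_def abs_mult[symmetric] by (rule sum_abs)
    also have "\<dots> \<le> (\<Sum>z\<in>Z. (of_bool (E y z) + q) * (of_bool (E y' z) + q))"
      using that abs_dev_le q_nonneg by (intro sum_mono mult_mono) auto
    also have "\<dots> = (\<Sum>z\<in>Z. of_bool (E y z) * of_bool (E y' z)) + q * (\<Sum>z\<in>Z. of_bool (E y z))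
        + q * (\<Sum>z\<in>Z. of_bool (E y' z)) + (\<Sum>z\<in>Z. q\<^sup>2)"
      unfolding sum_distrib_left sum.distrib[symmetric]
      by (intro sum.cong refl) (simp only: power2_eq_square algebra_simps)
    also have "\<dots> = codeg y y' + q * deg y + q * deg y' + q\<^sup>2 * m"
      by (simp only: codeg_def deg_def card_nbrs_eq_sum sum_nbrs finite_nbrs finite_V m_def sum_constant mult_ac)
    finally show ?thesis .
  qed
  have "(\<Sum>y\<in>Y. \<Sum>y'\<in>Y. (codev y y')\<^sup>2)
      \<le> (\<Sum>y\<in>Y. \<Sum>y'\<in>Y. 4 * ((codeg y y')\<^sup>2 + q\<^sup>2 * (deg y)\<^sup>2 + q\<^sup>2 * (deg y')\<^sup>2 + q ^ 4 * m\<^sup>2))"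
  proof (intro sum_mono)
    fix y y' assume "y \<in> Y" "y' \<in> Y"
    then have "\<bar>codev y y'\<bar>\<^sup>2 \<le> (codeg y y' + q * deg y + q * deg y' + q\<^sup>2 * m)\<^sup>2"
      by (intro power_mono abs_codev) auto
    also have "\<dots> \<le> 4 * ((codeg y y')\<^sup>2 + (q * deg y)\<^sup>2 + (q * deg y')\<^sup>2 + (q\<^sup>2 * m)\<^sup>2)"
      by (rule square_add4_le)
    finally show "(codev y y')\<^sup>2 \<le> 4 * ((codeg y y')\<^sup>2 + q\<^sup>2 * (deg y)\<^sup>2 + q\<^sup>2 * (deg y')\<^sup>2 + q ^ 4 * m\<^sup>2)"
      by (simp add: power_mult_distrib flip: power_mult)
  qed
  also have "\<dots> = 4 * ((\<Sum>y\<in>Y. \<Sum>y'\<in>Y. (codeg y y')\<^sup>2) + 2 * q\<^sup>2 * n * (\<Sum>y\<in>Y. (deg y)\<^sup>2) + q ^ 4 * n\<^sup>2 * m\<^sup>2)"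
    by (simp add: sum.distrib sum_distrib_left n_def power2_eq_square mult_ac)
  also have "\<dots> \<le> 4 * (46 * p ^ 4 * n\<^sup>2 * m\<^sup>2 + 2 * (4 * p\<^sup>2) * n * (9 * p\<^sup>2 * n * m\<^sup>2) + 16 * p ^ 4 * n\<^sup>2 * m\<^sup>2)"
    using codegree_square_sum_le degree_square_sum_le q_power_le nn q_nonneg p_pos
    by (intro mult_left_mono add_mono mult_mono)
       (auto simp: n_def m_def deg_def codeg_def intro!: sum_nonneg)
  also have "\<dots> = 536 * p ^ 4 * n\<^sup>2 * m\<^sup>2"
    by (simp add: field_simps eval_nat_numeral)
  finally show ?thesis by (simp add: n_def m_def)
qed

text \<open>
  The function \<open>z \<mapsto> dev y z * dev y' z\<close> is a combination of the indicators of \<open>N\<^sub>G(y) \<inter> N\<^sub>G(y')\<close>, \<open>N\<^sub>G(y)\<close>,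
  \<open>N\<^sub>G(y')\<close> and \<open>Z\<close> with coefficients \<open>1\<close>, \<open>- q\<close>, \<open>- q\<close>, \<open>q\<^sup>2\<close>, so a jumbled relation \<open>R\<close> barely correlates with it.
  The point is that the sets of neighbours are sparse, which makes the discrepancy bound correspondingly small.
\<close>

lemma jumbled_against_codeviation:
  fixes R :: "'d \<Rightarrow> 'c \<Rightarrow> bool"
  assumes "jumbled_pair R p \<delta> X Z" "A \<subseteq> X" "y \<in> Y" "y' \<in> Y"
  shows "(\<Sum>x\<in>A. \<bar>\<Sum>z\<in>Z. (of_bool (R x z) - p) * (dev y z * dev y' z)\<bar>) \<le> 2 * \<delta> * sqrt (card A) * wt y y'"
proof -
  interpret R: jumbled_pair R p \<delta> X Z by fact
  define K where "K x B = (\<Sum>z\<in>B. of_bool (R x z) - p)" for x B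
  define G1 where "G1 = nbrs G Z y"
  define G2 where "G2 = nbrs G Z y'"
  define G12 where "G12 = nbrs G (nbrs G Z y) y'"
  have subs: "G1 \<subseteq> nbrs E Z y" "G2 \<subseteq> nbrs E Z y'" "G12 \<subseteq> nbrs E (nbrs E Z y) y'"
    using G_sub assms by (auto simp: G1_def G2_def G12_def nbrs_def)
  have row: "(\<Sum>x\<in>A. \<bar>K x B\<bar>) \<le> 2 * \<delta> * sqrt (card A) * sqrt (card B')"
    if "B \<subseteq> B'" "B' \<subseteq> Z" for B B'
  proof -
    have "(\<Sum>x\<in>A. \<bar>K x B\<bar>) \<le> 2 * \<delta> * sqrt (card A) * sqrt (card B)"
      unfolding K_def using that assms by (intro R.row_discrepancy) auto
    also have "\<dots> \<le> 2 * \<delta> * sqrt (card A) * sqrt (card B')"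
      using that R.\<gamma>_nonneg finite_subset[OF that(2) finite_V]
      by (intro mult_left_mono real_sqrt_le_mono) (auto intro: card_mono)
    finally show ?thesis .
  qed
  have expand: "(\<Sum>z\<in>Z. (of_bool (R x z) - p) * (dev y z * dev y' z))
      = K x G12 - q * K x G1 - q * K x G2 + q\<^sup>2 * K x Z" for x
    unfolding K_def G12_def G1_def G2_def
    by (simp only: sum_nbrs finite_nbrs finite_V sum_distrib_left sum.distrib[symmetric] sum_subtractf[symmetric])
       (intro sum.cong refl, simp only: dev_def power2_eq_square algebra_simps)
  have "(\<Sum>x\<in>A. \<bar>\<Sum>z\<in>Z. (of_bool (R x z) - p) * (dev y z * dev y' z)\<bar>)
      \<le> (\<Sum>x\<in>A. \<bar>K x G12\<bar> + q * \<bar>K x G1\<bar> + q * \<bar>K x G2\<bar> + q\<^sup>2 * \<bar>K x Z\<bar>)"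
  proof (rule sum_mono)
    fix x
    have "\<bar>a - b - c + d\<bar> \<le> \<bar>a\<bar> + \<bar>b\<bar> + \<bar>c\<bar> + \<bar>d\<bar>" for a b c d :: real by linarith
    from this[of "K x G12" "q * K x G1" "q * K x G2" "q\<^sup>2 * K x Z"]
    show "\<bar>\<Sum>z\<in>Z. (of_bool (R x z) - p) * (dev y z * dev y' z)\<bar>
        \<le> \<bar>K x G12\<bar> + q * \<bar>K x G1\<bar> + q * \<bar>K x G2\<bar> + q\<^sup>2 * \<bar>K x Z\<bar>"
      unfolding expand using q_nonneg by (simp add: abs_mult)
  qed
  also have "\<dots> = (\<Sum>x\<in>A. \<bar>K x G12\<bar>) + q * (\<Sum>x\<in>A. \<bar>K x G1\<bar>) + q * (\<Sum>x\<in>A. \<bar>K x G2\<bar>) + q\<^sup>2 * (\<Sum>x\<in>A. \<bar>K x Z\<bar>)"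
    by (simp only: sum.distrib sum_distrib_left)
  also have "\<dots> \<le> 2 * \<delta> * sqrt (card A) * sqrt (codeg y y') + q * (2 * \<delta> * sqrt (card A) * sqrt (deg y))
      + q * (2 * \<delta> * sqrt (card A) * sqrt (deg y')) + q\<^sup>2 * (2 * \<delta> * sqrt (card A) * sqrt (card Z))"
    unfolding codeg_def deg_def
    using subs q_nonneg nbrs_subset[of E Z] nbrs_subset[of E "nbrs E Z y" y']
    by (intro add_mono mult_left_mono row) (auto simp: nbrs_def)
  also have "\<dots> = 2 * \<delta> * sqrt (card A) * wt y y'"
    by (simp add: wt_def algebra_simps)
  finally show ?thesis .
qed

text \<open>
  For a large set \<open>S\<close>, regularity says that all but \<open>2 \<epsilon> |Z|\<close> of the vertices \<open>z\<close> have nearly the expected number of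
  neighbours in \<open>S\<close>.  On the exceptional vertices, and everywhere if \<open>S\<close> is small, the second moment of the degrees
  in \<open>E\<close> is a sufficient bound.
\<close>

lemma row_deviation_square_sum:
  fixes \<epsilon> c :: real
  assumes \<epsilon>: "0 < \<epsilon>" "\<epsilon> \<le> 1"
    and regular: "\<And>S T. S \<subseteq> Y \<Longrightarrow> T \<subseteq> Z \<Longrightarrow> \<epsilon> * card Y \<le> card S \<Longrightarrow> \<epsilon> * card Z \<le> card T \<Longrightarrow>
      \<bar>\<Sum>y\<in>S. \<Sum>z\<in>T. dev y z\<bar> \<le> \<epsilon> * p * card S * card T"
    and \<gamma>: "\<gamma>\<^sup>2 \<le> c * p ^ 3 * card Y * card Z"
    and S: "S \<subseteq> Y"
  shows "(\<Sum>z\<in>Z. (\<Sum>y\<in>S. dev y z)\<^sup>2) \<le> (33 * \<epsilon> + 10 * c) * p\<^sup>2 * (card Y)\<^sup>2 * card Z"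
proof -
  interpret ZY: strongly_jumbled_pair "\<lambda>z y. E y z" p \<gamma> Z Y by (rule transposed_strong)
  define n m s where "n = real (card Y)" and "m = real (card Z)" and "s = real (card S)"
  define D where "D z = (\<Sum>y\<in>S. dev y z)" for z
  have finS: "finite S" using S finite_U finite_subset by blast
  have s_le: "s \<le> n" using S finite_U by (simp add: s_def n_def card_mono)
  have nn: "n \<ge> 0" "m \<ge> 0" "s \<ge> 0" by (simp_all add: n_def m_def s_def)
  have s2_le: "s\<^sup>2 \<le> n\<^sup>2" using s_le nn by (intro power_mono) auto
  have \<gamma>_term: "10 * \<gamma>\<^sup>2 * s / p \<le> 10 * c * p\<^sup>2 * n\<^sup>2 * m"
  proof -
    have "10 * \<gamma>\<^sup>2 * s / p \<le> 10 * (c * p ^ 3 * n * m) * n / p"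
      using \<gamma> s_le nn p_pos order_trans[OF zero_le_power2 \<gamma>]
      by (intro divide_right_mono mult_mono mult_left_mono) (auto simp: n_def m_def)
    also have "\<dots> = 10 * c * p\<^sup>2 * n\<^sup>2 * m" using p_pos by (simp add: eval_nat_numeral)
    finally show ?thesis .
  qed
  have subset_sum: "(\<Sum>z\<in>B. (D z)\<^sup>2) \<le> 16 * p\<^sup>2 * s\<^sup>2 * card B + 10 * c * p\<^sup>2 * n\<^sup>2 * m" if "B \<subseteq> Z" for B
  proof -
    define e where "e z = real (card (nbrs (\<lambda>z y. E y z) S z))" for z
    have "(\<Sum>z\<in>B. (D z)\<^sup>2) \<le> (\<Sum>z\<in>B. 2 * (e z)\<^sup>2 + 8 * p\<^sup>2 * s\<^sup>2)"
    proof (rule sum_mono)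
      fix z assume "z \<in> B"
      then have "\<bar>D z\<bar> \<le> (\<Sum>y\<in>S. of_bool (E y z) + q)"
        unfolding D_def using S that by (intro order_trans[OF sum_abs] sum_mono abs_dev_le) auto
      also have "\<dots> = e z + q * s"
        unfolding e_def card_nbrs_eq_sum[OF finS] s_def by (simp only: sum.distrib sum_constant mult_ac)
      finally have "\<bar>D z\<bar>\<^sup>2 \<le> (e z + q * s)\<^sup>2" by (intro power_mono) auto
      also have "\<dots> \<le> 2 * (e z)\<^sup>2 + 2 * (q * s)\<^sup>2" by (rule square_add_le)
      also have "2 * (q * s)\<^sup>2 \<le> 8 * p\<^sup>2 * s\<^sup>2"
        using mult_right_mono[OF q_power_le(1), of "s\<^sup>2"] by (simp add: power_mult_distrib)
      finally show "(D z)\<^sup>2 \<le> 2 * (e z)\<^sup>2 + 8 * p\<^sup>2 * s\<^sup>2" by simp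
    qed
    also have "\<dots> = 2 * (\<Sum>z\<in>B. (e z)\<^sup>2) + 8 * p\<^sup>2 * s\<^sup>2 * card B"
      by (simp add: sum.distrib sum_distrib_left)
    also have "(\<Sum>z\<in>B. (e z)\<^sup>2) \<le> 4 * p\<^sup>2 * s\<^sup>2 * card B + 5 * \<gamma>\<^sup>2 * s / p"
      using ZY.degree_square_sum[OF p_le that S] by (simp add: e_def s_def)
    finally show ?thesis using \<gamma>_term by (simp add: mult_ac)
  qed
  show ?thesis
  proof (cases "\<epsilon> * n \<le> s")
    case False
    have "s\<^sup>2 \<le> (\<epsilon> * n)\<^sup>2" using False nn by (intro power_mono) auto
    also have "\<dots> \<le> \<epsilon> * n\<^sup>2"
      unfolding power_mult_distrib using \<epsilon>
      by (intro mult_right_mono) (auto simp: power2_eq_square mult_left_le)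
    finally have "16 * p\<^sup>2 * s\<^sup>2 * m \<le> 16 * p\<^sup>2 * (\<epsilon> * n\<^sup>2) * m"
      using nn by (intro mult_right_mono mult_left_mono) auto
    also have "\<dots> \<le> 33 * p\<^sup>2 * (\<epsilon> * n\<^sup>2) * m" using \<epsilon> nn by (intro mult_right_mono) auto
    finally show ?thesis
      using subset_sum[OF subset_refl] by (simp add: D_def n_def m_def algebra_simps)
  next
    case True
    define P where "P = {z \<in> Z. \<epsilon> * p * s < D z}"
    define N where "N = {z \<in> Z. D z < - (\<epsilon> * p * s)}"
    have sub: "P \<subseteq> Z" "N \<subseteq> Z" by (auto simp: P_def N_def)
    have fin: "finite P" "finite N" using sub finite_V finite_subset by blast+
    have reg: "\<bar>\<Sum>z\<in>T. D z\<bar> \<le> \<epsilon> * p * s * card T" if "T \<subseteq> Z" "\<epsilon> * m \<le> card T" for T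
      using regular[OF S that(1)] True that unfolding D_def by (subst sum.swap) (simp add: n_def m_def s_def)
    \<comment> \<open>If P were large, regularity would apply to (S, P), on which every column deviates in the same direction.\<close>
    have cardP: "card P \<le> \<epsilon> * m"
    proof (rule ccontr)
      assume *: "\<not> card P \<le> \<epsilon> * m"
      have "\<epsilon> * m \<ge> 0" using \<epsilon> nn by simp
      with * have "P \<noteq> {}" by auto
      then have "(\<Sum>z\<in>P. \<epsilon> * p * s) < (\<Sum>z\<in>P. D z)"
        using fin by (intro sum_strict_mono) (auto simp: P_def)
      then show False using reg[OF sub(1)] * by (simp add: mult_ac)
    qed
    have cardN: "card N \<le> \<epsilon> * m"
    proof (rule ccontr)
      assume *: "\<not> card N \<le> \<epsilon> * m"
      have "\<epsilon> * m \<ge> 0" using \<epsilon> nn by simp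
      with * have "N \<noteq> {}" by auto
      then have "(\<Sum>z\<in>N. D z) < (\<Sum>z\<in>N. - (\<epsilon> * p * s))"
        using fin by (intro sum_strict_mono) (auto simp: N_def)
      then show False using reg[OF sub(2)] * by (simp add: mult_ac)
    qed
    have "card (P \<union> N) \<le> 2 * \<epsilon> * m"
      using card_Un_le[of P N] cardP cardN by linarith
    then have "16 * p\<^sup>2 * s\<^sup>2 * card (P \<union> N) \<le> 16 * p\<^sup>2 * n\<^sup>2 * (2 * \<epsilon> * m)"
      using s2_le nn by (intro mult_mono) auto
    with subset_sum[of "P \<union> N"] sub
    have exceptional: "(\<Sum>z\<in>P \<union> N. (D z)\<^sup>2) \<le> 32 * \<epsilon> * p\<^sup>2 * n\<^sup>2 * m + 10 * c * p\<^sup>2 * n\<^sup>2 * m"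
      by (simp add: mult_ac)
    have "(\<Sum>z\<in>Z - (P \<union> N). (D z)\<^sup>2) \<le> (\<Sum>z\<in>Z - (P \<union> N). \<epsilon> * p\<^sup>2 * n\<^sup>2)"
    proof (rule sum_mono)
      fix z assume "z \<in> Z - (P \<union> N)"
      then have "\<bar>D z\<bar> \<le> \<epsilon> * p * s" by (auto simp: P_def N_def)
      then have "\<bar>D z\<bar>\<^sup>2 \<le> (\<epsilon> * p * s)\<^sup>2" by (intro power_mono) auto
      also have "\<dots> = \<epsilon>\<^sup>2 * (p\<^sup>2 * s\<^sup>2)" by (simp add: power_mult_distrib)
      also have "\<dots> \<le> \<epsilon> * (p\<^sup>2 * n\<^sup>2)"
        using \<epsilon> s2_le by (intro mult_mono) (auto simp: power2_eq_square mult_left_le)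
      finally show "(D z)\<^sup>2 \<le> \<epsilon> * p\<^sup>2 * n\<^sup>2" by simp
    qed
    also have "\<dots> \<le> (\<Sum>z\<in>Z. \<epsilon> * p\<^sup>2 * n\<^sup>2)"
      using \<epsilon> finite_V by (intro sum_mono2) auto
    also have "\<dots> = \<epsilon> * p\<^sup>2 * n\<^sup>2 * m" by (simp add: m_def)
    finally have typical: "(\<Sum>z\<in>Z - (P \<union> N). (D z)\<^sup>2) \<le> \<epsilon> * p\<^sup>2 * n\<^sup>2 * m" .
    have "(\<Sum>z\<in>Z. (D z)\<^sup>2) = (\<Sum>z\<in>Z - (P \<union> N). (D z)\<^sup>2) + (\<Sum>z\<in>P \<union> N. (D z)\<^sup>2)"
      using sub finite_V by (intro sum.subset_diff) auto
    then show ?thesis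
      using exceptional typical by (simp add: D_def n_def m_def algebra_simps)
  qed
qed

text \<open>
  The positive parts suffice, since the sum of all codeviations is a sum of squares, hence nonnegative.  Their sum is
  \<open>Q\<close>, the sum of \<open>dev y' z * F y' z\<close>.  By Cauchy-Schwarz with the weight \<open>\<bar>dev\<bar>\<close>, which is at most
  \<open>(E - p) + (p + q)\<close>, it is enough to bound the sum of \<open>F\<^sup>2\<close> over \<open>Y \<times> Z\<close>, which is the hypothesis on rows, and its
  correlation with \<open>E - p\<close>.
\<close>

lemma codev_abs_sum:
  fixes \<beta> c :: real
  assumes rows: "\<And>S. S \<subseteq> Y \<Longrightarrow> (\<Sum>z\<in>Z. (\<Sum>y\<in>S. dev y z)\<^sup>2) \<le> \<beta> * p\<^sup>2 * (card Y)\<^sup>2 * card Z"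
    and c: "\<gamma> \<le> c * p\<^sup>2 * sqrt (real (card Y) * real (card Z))"
  shows "(\<Sum>y\<in>Y. \<Sum>y'\<in>Y. \<bar>codev y y'\<bar>) \<le> 4 * sqrt (16 * c + 3 * \<beta>) * p\<^sup>2 * (card Y)\<^sup>2 * card Z"
proof -
  define n m where "n = real (card Y)" and "m = real (card Z)"
  have nn: "n \<ge> 0" "m \<ge> 0" by (simp_all add: n_def m_def)
  \<comment> \<open>The first argument of h and F is the vertex y' that selects the set of rows to be summed.\<close>
  define h :: "'b \<Rightarrow> 'b \<Rightarrow> real" where "h y' y = of_bool (codev y y' > 0)" for y' y
  define F where "F y' z = (\<Sum>y\<in>Y. h y' y * dev y z)" for y' z
  define Q where "Q = (\<Sum>y'\<in>Y. \<Sum>z\<in>Z. dev y' z * F y' z)"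
  have Q_eq: "Q = (\<Sum>y'\<in>Y. \<Sum>y\<in>Y. h y' y * codev y y')"
  proof -
    have "(\<Sum>z\<in>Z. dev y' z * F y' z) = (\<Sum>y\<in>Y. h y' y * codev y y')" for y'
      unfolding F_def codev_def sum_distrib_left by (subst sum.swap) (simp only: mult_ac)
    then show ?thesis by (simp add: Q_def)
  qed
  have "(\<Sum>y\<in>Y. \<Sum>y'\<in>Y. codev y y') = (\<Sum>z\<in>Z. (\<Sum>y\<in>Y. dev y z)\<^sup>2)"
    by (simp only: codev_def sum_square_sum_eq)
  then have codev_sum_nonneg: "0 \<le> (\<Sum>y\<in>Y. \<Sum>y'\<in>Y. codev y y')"
    by (simp add: sum_nonneg)
  have "(\<Sum>y\<in>Y. \<Sum>y'\<in>Y. \<bar>codev y y'\<bar>) = (\<Sum>y\<in>Y. \<Sum>y'\<in>Y. 2 * (h y' y * codev y y') - codev y y')"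
    by (intro sum.cong refl) (auto simp: h_def)
  also have "\<dots> = 2 * Q - (\<Sum>y\<in>Y. \<Sum>y'\<in>Y. codev y y')"
    unfolding Q_eq by (subst (2) sum.swap) (simp only: sum_subtractf sum_distrib_left)
  finally have abs_le: "(\<Sum>y\<in>Y. \<Sum>y'\<in>Y. \<bar>codev y y'\<bar>) \<le> 2 * Q" using codev_sum_nonneg by simp

  have dev_sum: "(\<Sum>y\<in>Y. \<Sum>z\<in>Z. \<bar>dev y z\<bar>) \<le> 4 * p * n * m"
  proof -
    have "(\<Sum>y\<in>Y. \<Sum>z\<in>Z. \<bar>dev y z\<bar>) \<le> (\<Sum>y\<in>Y. \<Sum>z\<in>Z. of_bool (E y z) + q)"
      by (intro sum_mono abs_dev_le)
    also have "\<dots> = (\<Sum>y\<in>Y. deg y) + q * n * m"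
      by (simp only: sum.distrib deg_def card_nbrs_eq_sum finite_V sum_constant n_def m_def mult_ac)
    also have "\<dots> \<le> 2 * p * n * m + 2 * p * n * m"
      using degree_sum_le q_le nn by (intro add_mono mult_right_mono) (auto simp: deg_def n_def m_def)
    finally show ?thesis by (simp add: mult_ac)
  qed

  \<comment> \<open>For fixed y', F is the row sum over the set of all y with positive codeviation.\<close>
  have F_sum: "(\<Sum>y'\<in>Y. \<Sum>z\<in>Z. (F y' z)\<^sup>2) \<le> \<beta> * p\<^sup>2 * n ^ 3 * m"
  proof -
    have "(\<Sum>y'\<in>Y. \<Sum>z\<in>Z. (F y' z)\<^sup>2) \<le> (\<Sum>y'\<in>Y. \<beta> * p\<^sup>2 * n\<^sup>2 * m)"
    proof (rule sum_mono)
      fix y'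
      have "F y' z = (\<Sum>y\<in>Y \<inter> {y. codev y y' > 0}. dev y z)" for z
        unfolding F_def h_def using finite_U by simp
      then show "(\<Sum>z\<in>Z. (F y' z)\<^sup>2) \<le> \<beta> * p\<^sup>2 * n\<^sup>2 * m"
        using rows[of "Y \<inter> {y. codev y y' > 0}"] by (simp add: n_def m_def)
    qed
    also have "\<dots> = \<beta> * p\<^sup>2 * n ^ 3 * m" by (simp add: n_def eval_nat_numeral)
    finally show ?thesis .
  qed

  have wt_sum: "(\<Sum>y\<in>Y. \<Sum>y'\<in>Y. wt y y') \<le> 8 * p * n\<^sup>2 * sqrt m"
  proof -
    have "(\<Sum>y\<in>Y. \<Sum>y'\<in>Y. wt y y') = (\<Sum>y\<in>Y. \<Sum>y'\<in>Y. 1 * wt y y')" by simp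
    also have "\<dots> \<le> sqrt (\<Sum>y\<in>Y. \<Sum>y'\<in>Y. 1\<^sup>2) * sqrt (\<Sum>y\<in>Y. \<Sum>y'\<in>Y. (wt y y')\<^sup>2)"
      by (rule double_sum_mult_le_sqrt_mult_sqrt)
    also have "(\<Sum>y\<in>Y. \<Sum>y'\<in>Y. 1\<^sup>2) = n\<^sup>2" by (simp add: n_def power2_eq_square)
    also have "sqrt (\<Sum>y\<in>Y. \<Sum>y'\<in>Y. (wt y y')\<^sup>2) \<le> sqrt ((8 * p * n)\<^sup>2 * m)"
    proof (rule real_sqrt_le_mono)
      have "(\<Sum>y\<in>Y. \<Sum>y'\<in>Y. (wt y y')\<^sup>2) \<le> 56 * (p\<^sup>2 * n\<^sup>2 * m)"
        using wt_square_sum by (simp add: n_def m_def mult.assoc)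
      also have "\<dots> \<le> 64 * (p\<^sup>2 * n\<^sup>2 * m)" using nn by (intro mult_right_mono) auto
      finally show "(\<Sum>y\<in>Y. \<Sum>y'\<in>Y. (wt y y')\<^sup>2) \<le> (8 * p * n)\<^sup>2 * m" by (simp add: power_mult_distrib)
    qed
    also have "\<dots> = 8 * p * n * sqrt m" using nn p_pos by (simp add: real_sqrt_mult)
    finally show ?thesis using nn by (auto simp: power2_eq_square mult_ac intro: mult_right_mono)
  qed

  \<comment> \<open>Expanding F^2 gives a sum over y1, y2 of the correlation of E with their codeviation; the weights h lie
    between 0 and 1, so they disappear once absolute values are taken.\<close>
  have correlation: "(\<Sum>y'\<in>Y. \<Sum>z\<in>Z. (of_bool (E y' z) - p) * (F y' z)\<^sup>2) \<le> 16 * c * p ^ 3 * n ^ 3 * m"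
  proof -
    define k where "k y1 y2 y' = (\<Sum>z\<in>Z. (of_bool (E y' z) - p) * (dev y1 z * dev y2 z))" for y1 y2 y'
    have "(\<Sum>z\<in>Z. (of_bool (E y' z) - p) * (F y' z)\<^sup>2)
        = (\<Sum>y1\<in>Y. \<Sum>y2\<in>Y. h y' y1 * h y' y2 * k y1 y2 y')" for y'
    proof -
      have "(\<Sum>z\<in>Z. (of_bool (E y' z) - p) * (F y' z)\<^sup>2)
          = (\<Sum>z\<in>Z. \<Sum>y1\<in>Y. \<Sum>y2\<in>Y. (of_bool (E y' z) - p) * ((h y' y1 * dev y1 z) * (h y' y2 * dev y2 z)))"
        unfolding F_def power2_eq_square sum_product by (simp only: sum_distrib_left)
      also have "\<dots> = (\<Sum>y1\<in>Y. \<Sum>z\<in>Z. \<Sum>y2\<in>Y. (of_bool (E y' z) - p) * ((h y' y1 * dev y1 z) * (h y' y2 * dev y2 z)))"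
        by (rule sum.swap)
      also have "\<dots> = (\<Sum>y1\<in>Y. \<Sum>y2\<in>Y. \<Sum>z\<in>Z. (of_bool (E y' z) - p) * ((h y' y1 * dev y1 z) * (h y' y2 * dev y2 z)))"
        by (intro sum.cong refl sum.swap)
      also have "\<dots> = (\<Sum>y1\<in>Y. \<Sum>y2\<in>Y. h y' y1 * h y' y2 * k y1 y2 y')"
        unfolding k_def by (simp only: sum_distrib_left mult_ac)
      finally show ?thesis .
    qed
    then have "(\<Sum>y'\<in>Y. \<Sum>z\<in>Z. (of_bool (E y' z) - p) * (F y' z)\<^sup>2)
        = (\<Sum>y'\<in>Y. \<Sum>y1\<in>Y. \<Sum>y2\<in>Y. h y' y1 * h y' y2 * k y1 y2 y')" by simp
    also have "\<dots> \<le> (\<Sum>y'\<in>Y. \<Sum>y1\<in>Y. \<Sum>y2\<in>Y. \<bar>k y1 y2 y'\<bar>)"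
      by (intro sum_mono) (auto simp: h_def)
    also have "\<dots> = (\<Sum>y1\<in>Y. \<Sum>y2\<in>Y. \<Sum>y'\<in>Y. \<bar>k y1 y2 y'\<bar>)"
      by (subst sum.swap) (intro sum.cong refl sum.swap)
    also have "\<dots> \<le> (\<Sum>y1\<in>Y. \<Sum>y2\<in>Y. 2 * \<gamma> * sqrt n * wt y1 y2)"
      unfolding k_def n_def
      by (intro sum_mono jumbled_against_codeviation[where X = Y]) (auto intro: jumbled_pair_axioms)
    also have "\<dots> = 2 * \<gamma> * sqrt n * (\<Sum>y1\<in>Y. \<Sum>y2\<in>Y. wt y1 y2)"
      by (simp only: sum_distrib_left)
    also have "\<dots> \<le> 2 * (c * p\<^sup>2 * sqrt (n * m)) * sqrt n * (8 * p * n\<^sup>2 * sqrt m)"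
    proof (intro mult_mono wt_sum)
      show "\<gamma> \<le> c * p\<^sup>2 * sqrt (n * m)" using c by (simp add: n_def m_def)
      then have "0 \<le> c * p\<^sup>2 * sqrt (n * m)" using \<gamma>_nonneg by linarith
      then show "0 \<le> 2 * (c * p\<^sup>2 * sqrt (n * m)) * sqrt n" "0 \<le> 2 * (c * p\<^sup>2 * sqrt (n * m))"
        using nn by (auto intro: mult_nonneg_nonneg)
    qed (use nn \<gamma>_nonneg in \<open>auto intro!: sum_nonneg\<close>)
    also have "\<dots> = 2 * 8 * c * p ^ 3 * n\<^sup>2 * ((sqrt n * sqrt n) * (sqrt m * sqrt m))"
      by (simp only: real_sqrt_mult power2_eq_square power3_eq_cube mult_ac)
    also have "\<dots> = 16 * c * p ^ 3 * n ^ 3 * m"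
      using nn by (simp add: eval_nat_numeral)
    finally show ?thesis .
  qed

  have devF_sum: "(\<Sum>y'\<in>Y. \<Sum>z\<in>Z. \<bar>dev y' z\<bar> * (F y' z)\<^sup>2) \<le> (16 * c + 3 * \<beta>) * p ^ 3 * n ^ 3 * m"
  proof -
    have "(\<Sum>y'\<in>Y. \<Sum>z\<in>Z. \<bar>dev y' z\<bar> * (F y' z)\<^sup>2) \<le> (\<Sum>y'\<in>Y. \<Sum>z\<in>Z. (of_bool (E y' z) + q) * (F y' z)\<^sup>2)"
      by (intro sum_mono mult_right_mono abs_dev_le) auto
    also have "\<dots> = (\<Sum>y'\<in>Y. \<Sum>z\<in>Z. (of_bool (E y' z) - p) * (F y' z)\<^sup>2 + (p + q) * (F y' z)\<^sup>2)"
      by (intro sum.cong refl) (simp only: algebra_simps)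
    also have "\<dots> = (\<Sum>y'\<in>Y. \<Sum>z\<in>Z. (of_bool (E y' z) - p) * (F y' z)\<^sup>2) + (p + q) * (\<Sum>y'\<in>Y. \<Sum>z\<in>Z. (F y' z)\<^sup>2)"
      by (simp only: sum.distrib sum_distrib_left)
    also have "\<dots> \<le> 16 * c * p ^ 3 * n ^ 3 * m + (3 * p) * (\<beta> * p\<^sup>2 * n ^ 3 * m)"
      using correlation F_sum q_le q_nonneg p_pos
      by (intro add_mono mult_mono) (auto intro!: sum_nonneg)
    also have "\<dots> = (16 * c + 3 * \<beta>) * p ^ 3 * n ^ 3 * m" by (simp add: algebra_simps eval_nat_numeral)
    finally show ?thesis .
  qed

  have "Q \<le> (\<Sum>y'\<in>Y. \<Sum>z\<in>Z. sqrt \<bar>dev y' z\<bar> * (sqrt \<bar>dev y' z\<bar> * \<bar>F y' z\<bar>))"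
    unfolding Q_def
  proof (intro sum_mono)
    fix y' z
    show "dev y' z * F y' z \<le> sqrt \<bar>dev y' z\<bar> * (sqrt \<bar>dev y' z\<bar> * \<bar>F y' z\<bar>)"
      by (simp add: mult.assoc[symmetric] abs_mult[symmetric])
  qed
  also have "\<dots> \<le> sqrt (\<Sum>y'\<in>Y. \<Sum>z\<in>Z. (sqrt \<bar>dev y' z\<bar>)\<^sup>2) * sqrt (\<Sum>y'\<in>Y. \<Sum>z\<in>Z. (sqrt \<bar>dev y' z\<bar> * \<bar>F y' z\<bar>)\<^sup>2)"
    by (rule double_sum_mult_le_sqrt_mult_sqrt)
  also have "\<dots> = sqrt (\<Sum>y'\<in>Y. \<Sum>z\<in>Z. \<bar>dev y' z\<bar>) * sqrt (\<Sum>y'\<in>Y. \<Sum>z\<in>Z. \<bar>dev y' z\<bar> * (F y' z)\<^sup>2)"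
    by (simp add: power_mult_distrib)
  also have "\<dots> \<le> sqrt (4 * p * n * m) * sqrt ((16 * c + 3 * \<beta>) * p ^ 3 * n ^ 3 * m)"
    using dev_sum devF_sum nn p_pos
    by (intro mult_mono real_sqrt_le_mono) (auto intro!: sum_nonneg)
  also have "\<dots> = sqrt ((16 * c + 3 * \<beta>) * (2 * p\<^sup>2 * n\<^sup>2 * m)\<^sup>2)"
    unfolding real_sqrt_mult[symmetric] by (simp add: eval_nat_numeral mult_ac)
  also have "\<dots> = 2 * sqrt (16 * c + 3 * \<beta>) * p\<^sup>2 * n\<^sup>2 * m"
    using nn by (simp add: real_sqrt_mult)
  finally show ?thesis using abs_le by (simp add: n_def m_def)
qed

section \<open>Codeviation inside the neighbourhoods of vertices\<close>

text \<open>
  After exchanging sums, a pair \<open>y, y'\<close> is weighted by its common neighbourhood \<open>C y y'\<close> in \<open>X\<close>.  Replacing the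
  neighbourhood of \<open>x\<close> in \<open>Z\<close> by \<open>p\<close> times \<open>Z\<close> costs the correlation \<open>k\<close>, which jumbledness of \<open>(X, Z)\<close> bounds on
  average over \<open>C y y'\<close>; the main term involves only codegrees into \<open>X\<close> and codeviations.
\<close>

lemma codeviation_sum_over_neighbourhoods:
  fixes a :: "'d \<Rightarrow> 'b \<Rightarrow> bool" and b :: "'d \<Rightarrow> 'c \<Rightarrow> bool" and c \<tau> :: real
  assumes XY: "strongly_jumbled_pair a p \<gamma>\<^sub>1 X Y" and XZ: "jumbled_pair b p \<gamma>\<^sub>2 X Z"
    and \<gamma>\<^sub>1: "\<gamma>\<^sub>1 \<le> c * p\<^sup>2 * sqrt (real (card X) * real (card Y))"
    and \<gamma>\<^sub>2: "\<gamma>\<^sub>2 \<le> c * p ^ 3 * sqrt (real (card X) * real (card Z))"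
    and codev_le: "(\<Sum>y\<in>Y. \<Sum>y'\<in>Y. \<bar>codev y y'\<bar>) \<le> \<tau> * p\<^sup>2 * (card Y)\<^sup>2 * card Z"
  shows "(\<Sum>x\<in>X. \<Sum>y\<in>nbrs a Y x. \<Sum>y'\<in>nbrs a Y x. \<bar>\<Sum>z\<in>nbrs b Z x. dev y z * dev y' z\<bar>)
    \<le> (173 * c + 4 * \<tau>) * p ^ 5 * card X * (card Y)\<^sup>2 * card Z"
proof -
  interpret XY: strongly_jumbled_pair a p \<gamma>\<^sub>1 X Y by fact
  interpret YX: strongly_jumbled_pair "\<lambda>y x. a x y" p \<gamma>\<^sub>1 Y X by (rule XY.transposed_strong)
  interpret XZ: jumbled_pair b p \<gamma>\<^sub>2 X Z by fact
  define l n m where "l = real (card X)" and "n = real (card Y)" and "m = real (card Z)"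
  have nn: "l \<ge> 0" "n \<ge> 0" "m \<ge> 0" by (simp_all add: l_def n_def m_def)
  define C where "C y y' = nbrs (\<lambda>y x. a x y) (nbrs (\<lambda>y x. a x y) X y) y'" for y y'
  define k where "k x y y' = (\<Sum>z\<in>Z. (of_bool (b x z) - p) * (dev y z * dev y' z))" for x y y'
  define t where "t x y y' = \<bar>k x y y'\<bar> + p * \<bar>codev y y'\<bar>" for x y y'
  have split: "\<bar>\<Sum>z\<in>nbrs b Z x. dev y z * dev y' z\<bar> \<le> t x y y'" for x y y'
  proof -
    have "(\<Sum>z\<in>nbrs b Z x. dev y z * dev y' z) = k x y y' + p * codev y y'"
      unfolding sum_nbrs[OF finite_V] k_def codev_def sum_distrib_left sum.distrib[symmetric]
      by (intro sum.cong refl) (simp only: algebra_simps)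
    then show ?thesis using p_pos by (simp add: t_def abs_mult order_trans[OF abs_triangle_ineq])
  qed
  have C_sum: "(\<Sum>x\<in>C y y'. h x) = (\<Sum>x\<in>X. of_bool (a x y) * (of_bool (a x y') * h x))"
    for y y' and h :: "'d \<Rightarrow> real"
    unfolding C_def by (simp only: sum_nbrs finite_nbrs XY.finite_U mult_ac)
  have "(\<Sum>x\<in>X. \<Sum>y\<in>nbrs a Y x. \<Sum>y'\<in>nbrs a Y x. \<bar>\<Sum>z\<in>nbrs b Z x. dev y z * dev y' z\<bar>)
      \<le> (\<Sum>x\<in>X. \<Sum>y\<in>nbrs a Y x. \<Sum>y'\<in>nbrs a Y x. t x y y')"
    by (intro sum_mono split)
  also have "\<dots> = (\<Sum>x\<in>X. \<Sum>y\<in>Y. \<Sum>y'\<in>Y. of_bool (a x y) * (of_bool (a x y') * t x y y'))"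
    by (simp only: sum_nbrs finite_U sum_distrib_left)
  also have "\<dots> = (\<Sum>y\<in>Y. \<Sum>y'\<in>Y. \<Sum>x\<in>C y y'. t x y y')"
    unfolding C_sum by (subst sum.swap) (intro sum.cong refl sum.swap)
  also have "\<dots> = (\<Sum>y\<in>Y. \<Sum>y'\<in>Y. \<Sum>x\<in>C y y'. \<bar>k x y y'\<bar>)
      + p * (\<Sum>y\<in>Y. \<Sum>y'\<in>Y. real (card (C y y')) * \<bar>codev y y'\<bar>)"
    by (simp add: t_def sum.distrib sum_distrib_left mult_ac)
  also have "(\<Sum>y\<in>Y. \<Sum>y'\<in>Y. \<Sum>x\<in>C y y'. \<bar>k x y y'\<bar>) \<le> 46 * c * p ^ 5 * l * n\<^sup>2 * m"
  proof -
    have "(\<Sum>y\<in>Y. \<Sum>y'\<in>Y. \<Sum>x\<in>C y y'. \<bar>k x y y'\<bar>)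
        \<le> (\<Sum>y\<in>Y. \<Sum>y'\<in>Y. 2 * \<gamma>\<^sub>2 * sqrt (card (C y y')) * wt y y')"
      unfolding k_def
      by (intro sum_mono jumbled_against_codeviation[OF XZ]) (auto simp: C_def nbrs_def)
    also have "\<dots> = 2 * \<gamma>\<^sub>2 * (\<Sum>y\<in>Y. \<Sum>y'\<in>Y. sqrt (card (C y y')) * wt y y')"
      by (simp only: sum_distrib_left mult.assoc)
    also have "(\<Sum>y\<in>Y. \<Sum>y'\<in>Y. sqrt (card (C y y')) * wt y y')
        \<le> sqrt (\<Sum>y\<in>Y. \<Sum>y'\<in>Y. (sqrt (card (C y y')))\<^sup>2) * sqrt (\<Sum>y\<in>Y. \<Sum>y'\<in>Y. (wt y y')\<^sup>2)"
      by (rule double_sum_mult_le_sqrt_mult_sqrt)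
    also have "\<dots> \<le> sqrt (9 * p\<^sup>2 * n\<^sup>2 * l) * sqrt (56 * p\<^sup>2 * n\<^sup>2 * m)"
      using YX.codegree_sum_le wt_square_sum
      by (intro mult_mono real_sqrt_le_mono) (auto simp: C_def n_def l_def m_def intro!: sum_nonneg)
    also have "\<dots> = sqrt (504 * ((p\<^sup>2 * n\<^sup>2)\<^sup>2 * (l * m)))"
      unfolding real_sqrt_mult[symmetric] by (simp add: power2_eq_square mult_ac)
    also have "\<dots> \<le> sqrt (23\<^sup>2 * ((p\<^sup>2 * n\<^sup>2)\<^sup>2 * (l * m)))"
      using nn by (intro real_sqrt_le_mono mult_right_mono) auto
    also have "\<dots> = 23 * p\<^sup>2 * n\<^sup>2 * sqrt (l * m)"
      by (simp only: real_sqrt_mult real_sqrt_abs) (use nn in simp)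
    also have "2 * \<gamma>\<^sub>2 * (23 * p\<^sup>2 * n\<^sup>2 * sqrt (l * m))
        \<le> 2 * (c * p ^ 3 * sqrt (l * m)) * (23 * p\<^sup>2 * n\<^sup>2 * sqrt (l * m))"
      using \<gamma>\<^sub>2 nn by (intro mult_right_mono mult_left_mono) (auto simp: l_def m_def)
    also have "\<dots> = 46 * c * (p ^ 3 * p\<^sup>2) * n\<^sup>2 * (sqrt (l * m) * sqrt (l * m))"
      by (simp only: mult_ac)
    also have "\<dots> = 46 * c * p ^ 5 * l * n\<^sup>2 * m"
      using nn by (simp flip: power_add add: mult_ac)
    finally show ?thesis using XZ.\<gamma>_nonneg by (simp add: mult_left_mono)
  qed
  also have "(\<Sum>y\<in>Y. \<Sum>y'\<in>Y. real (card (C y y')) * \<bar>codev y y'\<bar>) \<le> (4 * \<tau> + 127 * c) * p ^ 4 * l * n\<^sup>2 * m"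
  proof -
    have "(\<Sum>y\<in>Y. \<Sum>y'\<in>Y. real (card (C y y')) * \<bar>codev y y'\<bar>)
        \<le> 4 * p\<^sup>2 * l * (\<Sum>y\<in>Y. \<Sum>y'\<in>Y. \<bar>codev y y'\<bar>)
          + sqrt (30 * \<gamma>\<^sub>1\<^sup>2 * n * l) * sqrt (\<Sum>y\<in>Y. \<Sum>y'\<in>Y. \<bar>codev y y'\<bar>\<^sup>2)"
      unfolding C_def l_def n_def by (rule YX.weighted_codegree_sum_le) simp
    also have "\<dots> \<le> 4 * p\<^sup>2 * l * (\<tau> * p\<^sup>2 * n\<^sup>2 * m)
          + sqrt (30 * \<gamma>\<^sub>1\<^sup>2 * n * l) * sqrt (536 * p ^ 4 * n\<^sup>2 * m\<^sup>2)"
      using codev_le codev_square_sum nn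
      by (intro add_mono mult_left_mono real_sqrt_le_mono) (auto simp: n_def m_def)
    also have "sqrt (30 * \<gamma>\<^sub>1\<^sup>2 * n * l) * sqrt (536 * p ^ 4 * n\<^sup>2 * m\<^sup>2)
        = sqrt (16080 * ((\<gamma>\<^sub>1 * (p\<^sup>2 * n * m))\<^sup>2 * (l * n)))"
      unfolding real_sqrt_mult[symmetric] by (simp add: eval_nat_numeral mult_ac)
    also have "\<dots> \<le> sqrt (127\<^sup>2 * ((\<gamma>\<^sub>1 * (p\<^sup>2 * n * m))\<^sup>2 * (l * n)))"
      using nn by (intro real_sqrt_le_mono mult_right_mono) auto
    also have "\<dots> = 127 * (\<gamma>\<^sub>1 * (p\<^sup>2 * n * m) * sqrt (l * n))"
      by (simp only: real_sqrt_mult real_sqrt_abs) (use nn XY.\<gamma>_nonneg in simp)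
    also have "\<dots> \<le> 127 * (c * p\<^sup>2 * sqrt (l * n) * (p\<^sup>2 * n * m) * sqrt (l * n))"
      using \<gamma>\<^sub>1 nn by (intro mult_left_mono mult_right_mono) (auto simp: l_def n_def)
    also have "\<dots> = 127 * c * (p\<^sup>2 * p\<^sup>2) * n * m * (sqrt (l * n) * sqrt (l * n))"
      by (simp only: mult_ac)
    also have "\<dots> = 127 * c * (p\<^sup>2 * p\<^sup>2) * n * m * (l * n)" using nn by simp
    also have "4 * p\<^sup>2 * l * (\<tau> * p\<^sup>2 * n\<^sup>2 * m) + 127 * c * (p\<^sup>2 * p\<^sup>2) * n * m * (l * n)
        = (4 * \<tau> + 127 * c) * p ^ 4 * l * n\<^sup>2 * m"
      by (simp add: algebra_simps eval_nat_numeral)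
    finally show ?thesis by simp
  qed
  also have "46 * c * p ^ 5 * l * n\<^sup>2 * m + p * ((4 * \<tau> + 127 * c) * p ^ 4 * l * n\<^sup>2 * m)
      = (173 * c + 4 * \<tau>) * p ^ 5 * l * n\<^sup>2 * m"
    by (simp add: algebra_simps eval_nat_numeral)
  finally show ?thesis using p_pos by (simp add: l_def n_def m_def)
qed

end

text \<open>
  The single application of Cauchy-Schwarz that bounds the deviation on every pair of subsets at once.
\<close>

lemma square_double_sum_le:
  fixes g :: "'b \<Rightarrow> 'c \<Rightarrow> real"
  assumes "finite A" "finite B" "U \<subseteq> A" "W \<subseteq> B"
  shows "(\<Sum>y\<in>U. \<Sum>z\<in>W. g y z)\<^sup>2 \<le> card W * (\<Sum>y\<in>A. \<Sum>y'\<in>A. \<bar>\<Sum>z\<in>B. g y z * g y' z\<bar>)"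
proof -
  have "(\<Sum>y\<in>U. \<Sum>z\<in>W. g y z)\<^sup>2 = (\<Sum>z\<in>W. \<Sum>y\<in>U. g y z)\<^sup>2"
    by (subst sum.swap) simp
  also have "\<dots> \<le> card W * (\<Sum>z\<in>W. (\<Sum>y\<in>U. g y z)\<^sup>2)"
    by (rule square_sum_le)
  also have "\<dots> \<le> card W * (\<Sum>z\<in>B. (\<Sum>y\<in>U. g y z)\<^sup>2)"
    using assms by (intro mult_left_mono sum_mono2) auto
  also have "(\<Sum>z\<in>B. (\<Sum>y\<in>U. g y z)\<^sup>2) = (\<Sum>y\<in>U. \<Sum>y'\<in>U. \<Sum>z\<in>B. g y z * g y' z)"
    by (rule sum_square_sum_eq)
  also have "\<dots> \<le> (\<Sum>y\<in>U. \<Sum>y'\<in>U. \<bar>\<Sum>z\<in>B. g y z * g y' z\<bar>)"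
    by (intro sum_mono) auto
  also have "\<dots> \<le> (\<Sum>y\<in>U. \<Sum>y'\<in>A. \<bar>\<Sum>z\<in>B. g y z * g y' z\<bar>)"
    using assms by (intro sum_mono sum_mono2) auto
  also have "\<dots> \<le> (\<Sum>y\<in>A. \<Sum>y'\<in>A. \<bar>\<Sum>z\<in>B. g y z * g y' z\<bar>)"
    using assms by (intro sum_mono2) (auto intro: sum_nonneg)
  finally show ?thesis by (simp add: mult_left_mono)
qed

section \<open>Small deviation in most neighbourhoods\<close>

text \<open>
  Regularity of the pair \<open>(A, B)\<close> with parameter \<open>\<delta>\<close>, measured against a fixed density instead of that of the pair
  itself; the factor \<open>1/2\<close> leaves room for the passage to the density of the pair.
\<close>

definition small_deviation :: "('b \<Rightarrow> 'c \<Rightarrow> real) \<Rightarrow> real \<Rightarrow> real \<Rightarrow> 'b set \<Rightarrow> 'c set \<Rightarrow> bool" where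
  "small_deviation g p \<delta> A B \<longleftrightarrow>
     (\<forall>U W. U \<subseteq> A \<longrightarrow> W \<subseteq> B \<longrightarrow> \<delta> * card A \<le> card U \<longrightarrow> \<delta> * card B \<le> card W \<longrightarrow>
        \<bar>\<Sum>y\<in>U. \<Sum>z\<in>W. g y z\<bar> \<le> \<delta> / 2 * p * card U * card W)"

lemma small_deviation_if_codeviation_small:
  fixes g :: "'b \<Rightarrow> 'c \<Rightarrow> real"
  assumes fin: "finite A" "finite B" and pos: "0 < p" "0 < \<delta>" "0 \<le> n" "0 \<le> m"
    and sizes: "p / 2 * n \<le> card A" "p / 2 * m \<le> card B"
    and small: "(\<Sum>y\<in>A. \<Sum>y'\<in>A. \<bar>\<Sum>z\<in>B. g y z * g y' z\<bar>) \<le> \<delta> ^ 5 / 32 * p ^ 5 * n\<^sup>2 * m"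
  shows "small_deviation g p \<delta> A B"
  unfolding small_deviation_def
proof (intro allI impI)
  fix U W assume U: "U \<subseteq> A" "\<delta> * card A \<le> card U" and W: "W \<subseteq> B" "\<delta> * card B \<le> card W"
  have cU: "\<delta> * (p / 2 * n) \<le> card U"
    using mult_left_mono[OF sizes(1), of \<delta>] U pos by linarith
  have cW: "\<delta> * (p / 2 * m) \<le> card W"
    using mult_left_mono[OF sizes(2), of \<delta>] W pos by linarith
  have "(\<Sum>y\<in>U. \<Sum>z\<in>W. g y z)\<^sup>2 \<le> card W * (\<delta> ^ 5 / 32 * p ^ 5 * n\<^sup>2 * m)"
    using order_trans[OF square_double_sum_le[OF fin U(1) W(1), of g] mult_left_mono[OF small]] by simp
  also have "\<dots> = \<delta>\<^sup>2 / 4 * p\<^sup>2 * card W * ((\<delta> * (p / 2 * n))\<^sup>2 * (\<delta> * (p / 2 * m)))"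
    by (simp add: power_mult_distrib power_divide numeral_eq_Suc)
  also have "\<dots> \<le> \<delta>\<^sup>2 / 4 * p\<^sup>2 * card W * ((card U)\<^sup>2 * card W)"
    using pos mult_mono[OF power_mono[OF cU, of 2] cW] by (intro mult_left_mono) auto
  also have "\<dots> = (\<delta> / 2 * p * card U * card W)\<^sup>2"
    by (simp add: power2_eq_square mult_ac)
  finally have "\<bar>\<Sum>y\<in>U. \<Sum>z\<in>W. g y z\<bar>\<^sup>2 \<le> (\<delta> / 2 * p * card U * card W)\<^sup>2" by simp
  then show "\<bar>\<Sum>y\<in>U. \<Sum>z\<in>W. g y z\<bar> \<le> \<delta> / 2 * p * card U * card W"
    by (rule power2_le_imp_le) (use pos in auto)
qed

lemma card_exceeding_le_Markov:
  fixes \<kappa> :: "'d \<Rightarrow> real" and r :: real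
  assumes "finite X" "\<And>x. 0 \<le> \<kappa> x" "0 < K" "sum \<kappa> X \<le> K * r"
  shows "card {x \<in> X. K < \<kappa> x} \<le> r"
proof -
  have "K * card {x \<in> X. K < \<kappa> x} = (\<Sum>x\<in>{x \<in> X. K < \<kappa> x}. K)" by simp
  also have "\<dots> \<le> (\<Sum>x\<in>{x \<in> X. K < \<kappa> x}. \<kappa> x)" by (intro sum_mono) auto
  also have "\<dots> \<le> sum \<kappa> X" using assms by (intro sum_mono2) auto
  finally have "K * card {x \<in> X. K < \<kappa> x} \<le> K * r" using assms(4) by linarith
  then show ?thesis using assms(3) by (rule mult_left_le_imp_le)
qed

text \<open>
  Inheritance by subsets of constant proportion: with \<open>p \<ge> 1/4\<close>, a \<open>\<delta>\<close>-fraction of a set of size at least \<open>p/2\<close>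
  times the whole is at least a \<open>\<delta>/8\<close>-fraction of the whole.
\<close>

lemma small_deviation_slice:
  fixes g :: "'b \<Rightarrow> 'c \<Rightarrow> real" and p \<delta> \<epsilon> :: real
  assumes regular: "\<And>S T. S \<subseteq> Y \<Longrightarrow> T \<subseteq> Z \<Longrightarrow> \<epsilon> * card Y \<le> card S \<Longrightarrow> \<epsilon> * card Z \<le> card T \<Longrightarrow>
      \<bar>\<Sum>y\<in>S. \<Sum>z\<in>T. g y z\<bar> \<le> \<epsilon> * p * card S * card T"
    and p: "1/4 \<le> p" and \<delta>: "0 < \<delta>" and \<epsilon>: "\<epsilon> \<le> \<delta> / 8"
    and sub: "A \<subseteq> Y" "B \<subseteq> Z" and sizes: "p / 2 * card Y \<le> card A" "p / 2 * card Z \<le> card B"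
  shows "small_deviation g p \<delta> A B"
  unfolding small_deviation_def
proof (intro allI impI)
  fix U W assume U: "U \<subseteq> A" "\<delta> * card A \<le> card U" and W: "W \<subseteq> B" "\<delta> * card B \<le> card W"
  have large: "\<epsilon> * k \<le> j" if "\<delta> * i \<le> j" "p / 2 * k \<le> i" "0 \<le> k" for i j k :: real
  proof -
    have "\<epsilon> * k \<le> \<delta> * ((1/4) / 2 * k)" using mult_right_mono[OF \<epsilon> that(3)] by simp
    also have "\<dots> \<le> \<delta> * (p / 2 * k)" using p \<delta> that by (intro mult_left_mono mult_right_mono) auto
    also have "\<dots> \<le> \<delta> * i" using that \<delta> by (intro mult_left_mono) auto
    finally show ?thesis using that by simp
  qed
  have "\<bar>\<Sum>y\<in>U. \<Sum>z\<in>W. g y z\<bar> \<le> \<epsilon> * p * card U * card W"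
    using U W sub sizes by (intro regular large[of "card A"] large[of "card B"]) auto
  also have "\<dots> \<le> \<delta> / 2 * p * card U * card W"
    using \<epsilon> \<delta> p by (intro mult_right_mono) auto
  finally show "\<bar>\<Sum>y\<in>U. \<Sum>z\<in>W. g y z\<bar> \<le> \<delta> / 2 * p * card U * card W" .
qed

text \<open>
  Here the constants are fixed.  With \<open>t\<close> for both \<open>\<epsilon>\<close> and \<open>c\<close>, the total codeviation inside the neighbourhoods is at
  most \<open>426 \<surd>t\<close> times \<open>p\<^sup>5 |X| |Y|\<^sup>2 |Z|\<close>.  Markov's inequality needs the factor \<open>(\<delta>\<^sup>5 / 32) (\<delta> / 2)\<close>, the value of
  \<open>426 \<surd>t\<close> for the given \<open>t\<close>.
\<close>

lemma (in jumbled_subgraph) card_large_deviation_le: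
  fixes a :: "'d \<Rightarrow> 'b \<Rightarrow> bool" and b :: "'d \<Rightarrow> 'c \<Rightarrow> bool"
    and t \<delta> :: real
  assumes XY: "jumbled_pair a p \<gamma>\<^sub>1 X Y" and XZ: "jumbled_pair b p \<gamma>\<^sub>2 X Z"
    and \<gamma>\<^sub>1: "\<gamma>\<^sub>1 \<le> t * p\<^sup>2 * sqrt (real (card X) * real (card Y))"
    and \<gamma>\<^sub>2: "\<gamma>\<^sub>2 \<le> t * p ^ 3 * sqrt (real (card X) * real (card Z))"
    and \<gamma>: "\<gamma> \<le> t * p powr (5 / 2) * sqrt (real (card Y) * real (card Z))"
    and nonempty: "Y \<noteq> {}" "Z \<noteq> {}"
    and regular: "\<And>S T. S \<subseteq> Y \<Longrightarrow> T \<subseteq> Z \<Longrightarrow> t * card Y \<le> card S \<Longrightarrow> t * card Z \<le> card T \<Longrightarrow>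
      \<bar>\<Sum>y\<in>S. \<Sum>z\<in>T. dev y z\<bar> \<le> t * p * card S * card T"
    and \<delta>: "0 < \<delta>" "\<delta> \<le> 1" and t: "t = (\<delta> ^ 6 / 27264)\<^sup>2"
  shows "card {x \<in> X. p / 2 * card Y \<le> card (nbrs a Y x) \<and> p / 2 * card Z \<le> card (nbrs b Z x)
           \<and> \<not> small_deviation dev p \<delta> (nbrs a Y x) (nbrs b Z x)} \<le> \<delta> / 2 * card X"
proof -
  interpret XY: jumbled_pair a p \<gamma>\<^sub>1 X Y by fact
  define s where "s = \<delta> ^ 6 / 27264"
  have s: "0 < s" "s \<le> 1" and t_s: "t = s\<^sup>2"
    using \<delta> power_le_one[of \<delta> 6] by (auto simp: s_def t)
  have t01: "0 < t" "t \<le> 1" using s by (auto simp: t_s power_le_one)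
  have t_le_s: "t \<le> s" using s by (simp add: t_s power2_eq_square mult_left_le)
  define l n m where "l = real (card X)" and "n = real (card Y)" and "m = real (card Z)"
  have nn: "l \<ge> 0" and pos: "n > 0" "m > 0"
    using nonempty finite_U finite_V by (simp_all add: l_def n_def m_def card_gt_0_iff)
  have p1: "p \<le> 1" using p_le by simp

  have t2: "t\<^sup>2 \<le> t" "t\<^sup>2 \<le> 1" using t01 by (auto simp: power2_eq_square mult_left_le mult_le_one)
  have \<gamma>1_sq: "\<gamma>\<^sub>1\<^sup>2 \<le> p ^ 4 * card X * card Y"
  proof -
    have "\<gamma>\<^sub>1\<^sup>2 \<le> (t * p\<^sup>2 * sqrt (l * n))\<^sup>2"
      using \<gamma>\<^sub>1 XY.\<gamma>_nonneg by (intro power_mono) (auto simp: l_def n_def)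
    also have "\<dots> = t\<^sup>2 * (p ^ 4 * l * n)" using nn pos by (simp add: power_mult_distrib flip: power_mult)
    also have "\<dots> \<le> 1 * (p ^ 4 * l * n)" using t2 nn pos by (intro mult_right_mono) auto
    finally show ?thesis by (simp add: l_def n_def)
  qed
  then have XYs: "strongly_jumbled_pair a p \<gamma>\<^sub>1 X Y"
    by (intro strongly_jumbled_pair.intro strongly_jumbled_pair_axioms.intro XY p_le)
  have p_powr: "p powr (5 / 2) \<le> p\<^sup>2" "(p powr (5 / 2))\<^sup>2 \<le> p ^ 3"
  proof -
    have "p powr (5 / 2) \<le> p powr 2" using p_pos p1 by (intro powr_mono') auto
    then show "p powr (5 / 2) \<le> p\<^sup>2" using p_pos by simp
    have "(p powr (5 / 2))\<^sup>2 = p ^ 5" using p_pos by (rule powr_five_halves_square)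
    also have "\<dots> \<le> p ^ 3" using p_pos p1 by (intro power_decreasing) auto
    finally show "(p powr (5 / 2))\<^sup>2 \<le> p ^ 3" .
  qed
  have \<gamma>_lin: "\<gamma> \<le> t * p\<^sup>2 * sqrt (real (card Y) * real (card Z))"
    using p_powr t01 by (intro order_trans[OF \<gamma>] mult_right_mono mult_left_mono) auto
  have \<gamma>_sq: "\<gamma>\<^sup>2 \<le> t * p ^ 3 * card Y * card Z"
  proof -
    have "\<gamma>\<^sup>2 \<le> (t * p powr (5 / 2) * sqrt (n * m))\<^sup>2"
      using \<gamma> \<gamma>_nonneg by (intro power_mono) (auto simp: n_def m_def)
    also have "\<dots> = (t\<^sup>2 * (p powr (5 / 2))\<^sup>2) * (n * m)" using pos by (simp add: power_mult_distrib)
    also have "\<dots> \<le> (t * p ^ 3) * (n * m)"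
      using t2 p_powr pos t01 by (intro mult_right_mono mult_mono) auto
    finally show ?thesis by (simp add: n_def m_def)
  qed
  define \<tau> where "\<tau> = 4 * sqrt (16 * t + 3 * (33 * t + 10 * t))"
  have "(\<Sum>y\<in>Y. \<Sum>y'\<in>Y. \<bar>codev y y'\<bar>) \<le> \<tau> * p\<^sup>2 * (card Y)\<^sup>2 * card Z"
    unfolding \<tau>_def
    by (intro codev_abs_sum row_deviation_square_sum regular \<gamma>_lin \<gamma>_sq t01)
  from codeviation_sum_over_neighbourhoods[OF XYs XZ \<gamma>\<^sub>1 \<gamma>\<^sub>2 this]
  have "(\<Sum>x\<in>X. \<Sum>y\<in>nbrs a Y x. \<Sum>y'\<in>nbrs a Y x. \<bar>\<Sum>z\<in>nbrs b Z x. dev y z * dev y' z\<bar>)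
      \<le> (173 * t + 4 * \<tau>) * (p ^ 5 * l * n\<^sup>2 * m)"
    by (simp add: l_def n_def m_def mult.assoc)
  also have "\<dots> \<le> \<delta> ^ 6 / 64 * (p ^ 5 * l * n\<^sup>2 * m)"
  proof (rule mult_right_mono)
    have "\<tau> = 4 * (sqrt 145 * s)" using s by (simp add: \<tau>_def t_s real_sqrt_mult)
    moreover have "sqrt 145 \<le> 13" by (rule real_le_lsqrt) auto
    ultimately have "\<tau> \<le> 52 * s" using s by simp
    then have "173 * t + 4 * \<tau> \<le> 426 * s" using t_le_s s by linarith
    then show "173 * t + 4 * \<tau> \<le> \<delta> ^ 6 / 64" by (simp add: s_def)
  qed (use nn pos p_pos in auto)
  also have "\<delta> ^ 6 = \<delta> ^ 5 * \<delta>" by (simp add: eval_nat_numeral)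
  also have "\<delta> ^ 5 * \<delta> / 64 * (p ^ 5 * l * n\<^sup>2 * m) = (\<delta> ^ 5 / 32 * p ^ 5 * n\<^sup>2 * m) * (\<delta> / 2 * l)"
    by simp
  finally have total: "(\<Sum>x\<in>X. \<Sum>y\<in>nbrs a Y x. \<Sum>y'\<in>nbrs a Y x. \<bar>\<Sum>z\<in>nbrs b Z x. dev y z * dev y' z\<bar>)
      \<le> (\<delta> ^ 5 / 32 * p ^ 5 * n\<^sup>2 * m) * (\<delta> / 2 * l)" .
  define \<kappa> where "\<kappa> x = (\<Sum>y\<in>nbrs a Y x. \<Sum>y'\<in>nbrs a Y x. \<bar>\<Sum>z\<in>nbrs b Z x. dev y z * dev y' z\<bar>)" for x
  have "card {x \<in> X. \<delta> ^ 5 / 32 * p ^ 5 * n\<^sup>2 * m < \<kappa> x} \<le> \<delta> / 2 * l"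
    using total \<delta> p_pos pos XY.finite_U
    by (intro card_exceeding_le_Markov) (auto simp: \<kappa>_def intro!: sum_nonneg)
  moreover have "card {x \<in> X. p / 2 * card Y \<le> card (nbrs a Y x) \<and> p / 2 * card Z \<le> card (nbrs b Z x)
      \<and> \<not> small_deviation dev p \<delta> (nbrs a Y x) (nbrs b Z x)}
    \<le> card {x \<in> X. \<delta> ^ 5 / 32 * p ^ 5 * n\<^sup>2 * m < \<kappa> x}"
  proof (rule card_mono)
    show "{x \<in> X. p / 2 * card Y \<le> card (nbrs a Y x) \<and> p / 2 * card Z \<le> card (nbrs b Z x)
        \<and> \<not> small_deviation dev p \<delta> (nbrs a Y x) (nbrs b Z x)}
      \<subseteq> {x \<in> X. \<delta> ^ 5 / 32 * p ^ 5 * n\<^sup>2 * m < \<kappa> x}"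
    proof safe
      fix x assume x: "p / 2 * card Y \<le> card (nbrs a Y x)" "p / 2 * card Z \<le> card (nbrs b Z x)"
        "\<not> small_deviation dev p \<delta> (nbrs a Y x) (nbrs b Z x)"
      show "\<delta> ^ 5 / 32 * p ^ 5 * n\<^sup>2 * m < \<kappa> x"
      proof (rule ccontr)
        assume "\<not> ?thesis"
        then have "small_deviation dev p \<delta> (nbrs a Y x) (nbrs b Z x)"
          using x p_pos \<delta> pos finite_U finite_V
          by (intro small_deviation_if_codeviation_small[where n = n and m = m])
             (auto simp: \<kappa>_def n_def m_def)
        with x show False by simp
      qed
    qed
  qed (use XY.finite_U in simp)
  ultimately show ?thesis by (simp add: l_def)
qed

section \<open>Regularity inheritance in graphs\<close>

lemma edges_between_eq_sum:
  assumes "finite U" "finite W"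
  shows "real (edges_between G U W) = (\<Sum>u\<in>U. \<Sum>w\<in>W. of_bool ((u, w) \<in> parcs G))"
proof -
  have "(\<Sum>u\<in>U. \<Sum>w\<in>W. of_bool ((u, w) \<in> parcs G)) = (\<Sum>e\<in>U \<times> W. of_bool (e \<in> parcs G) :: real)"
    by (simp only: sum.cartesian_product case_prod_unfold prod.collapse)
  also have "\<dots> = card (U \<times> W \<inter> parcs G)"
    using assms by simp
  finally show ?thesis by (simp add: edges_between_def Int_commute)
qed

lemma sum_deviation_eq:
  fixes q :: real
  assumes "finite U" "finite W"
  shows "(\<Sum>u\<in>U. \<Sum>w\<in>W. of_bool ((u, w) \<in> parcs G) - q) = real (edges_between G U W) - q * card U * card W"
  using assms by (simp only: edges_between_eq_sum sum_subtractf) simp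

lemma jumbled_pair_if_bijumbled:
  assumes "pair_graph \<Gamma>" "bijumbled \<Gamma> p \<gamma> U V" "0 < p" "0 \<le> \<gamma>'" "\<gamma> \<le> \<gamma>'"
  shows "jumbled_pair (\<lambda>u v. (u, v) \<in> parcs \<Gamma>) p \<gamma>' U V"
proof -
  interpret pair_graph \<Gamma> by fact
  have fin: "finite U" "finite V"
    using assms(2) finite_subset[OF _ pair_finite_verts] by (auto simp: bijumbled_def)
  show ?thesis
  proof
    fix A B assume AB: "A \<subseteq> U" "B \<subseteq> V"
    then have "finite A" "finite B" using fin finite_subset by auto
    then have "\<bar>\<Sum>u\<in>A. \<Sum>v\<in>B. of_bool ((u, v) \<in> parcs \<Gamma>) - p\<bar> \<le> \<gamma> * sqrt (real (card A) * real (card B))"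
      using assms(2) AB by (simp add: sum_deviation_eq bijumbled_def)
    also have "\<dots> \<le> \<gamma>' * sqrt (real (card A) * real (card B))"
      using assms by (intro mult_right_mono) auto
    finally show "\<bar>\<Sum>u\<in>A. \<Sum>v\<in>B. of_bool ((u, v) \<in> parcs \<Gamma>) - p\<bar> \<le> \<gamma>' * sqrt (real (card A) * real (card B))" .
  qed (use assms fin in auto)
qed

lemma p_density_deviation_le_iff:
  assumes "finite U" "finite W" "U \<noteq> {}" "W \<noteq> {}" "0 < p"
  shows "\<bar>p_density G p U W - D\<bar> \<le> r \<longleftrightarrow>
    \<bar>\<Sum>u\<in>U. \<Sum>w\<in>W. of_bool ((u, w) \<in> parcs G) - D * p\<bar> \<le> r * p * card U * card W"
proof -
  define k where "k = p * real (card U) * real (card W)"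
  have k: "k > 0" using assms by (simp add: k_def card_gt_0_iff)
  have "(\<Sum>u\<in>U. \<Sum>w\<in>W. of_bool ((u, w) \<in> parcs G) - D * p) = edges_between G U W - D * k"
    using sum_deviation_eq[OF assms(1,2), of G "D * p"] by (simp add: k_def mult.assoc)
  then have "p_density G p U W - D = (\<Sum>u\<in>U. \<Sum>w\<in>W. of_bool ((u, w) \<in> parcs G) - D * p) / k"
    using k by (simp add: p_density_def k_def[symmetric] diff_divide_distrib)
  then have "\<bar>p_density G p U W - D\<bar> \<le> r \<longleftrightarrow> \<bar>\<Sum>u\<in>U. \<Sum>w\<in>W. of_bool ((u, w) \<in> parcs G) - D * p\<bar> \<le> r * k"
    using k by (simp add: abs_divide pos_divide_le_eq)
  then show ?thesis by (simp add: k_def mult.assoc)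
qed

lemma dense_regular_pair_if_small_deviation:
  assumes dev: "small_deviation (\<lambda>y z. of_bool ((y, z) \<in> parcs G) - D * p) p \<delta> A B"
    and fin: "finite A" "finite B" and nonempty: "A \<noteq> {}" "B \<noteq> {}"
    and verts: "A \<subseteq> pverts G" "B \<subseteq> pverts G" "A \<inter> B = {}"
    and p: "0 < p" and \<delta>: "0 < \<delta>" "\<delta> \<le> 1" "\<delta> \<le> \<epsilon>'" and D: "d - \<delta> / 2 \<le> D"
  shows "dense_regular_pair G \<epsilon>' d p A B"
proof -
  have close: "\<bar>p_density G p U W - D\<bar> \<le> \<delta> / 2"
    if "U \<subseteq> A" "W \<subseteq> B" "\<delta> * card A \<le> card U" "\<delta> * card B \<le> card W" for U W
  proof -
    have "\<delta> * card A > 0" "\<delta> * card B > 0" using fin nonempty \<delta> by (auto simp: card_gt_0_iff)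
    then have "U \<noteq> {}" "W \<noteq> {}" using that by auto
    moreover have "finite U" "finite W" using that fin finite_subset by auto
    ultimately show ?thesis
      using dev that p by (subst p_density_deviation_le_iff) (auto simp: small_deviation_def)
  qed
  have whole: "\<bar>p_density G p A B - D\<bar> \<le> \<delta> / 2"
    using \<delta> by (intro close) (auto simp: mult_left_le_one_le)
  have "regular_pair G \<epsilon>' p A B"
    unfolding regular_pair_def
  proof (intro conjI allI impI verts nonempty)
    fix U W assume "U \<subseteq> A" "W \<subseteq> B" and *: "\<epsilon>' * real (card A) \<le> real (card U)" "\<epsilon>' * real (card B) \<le> real (card W)"
    moreover have "\<delta> * card A \<le> card U" "\<delta> * card B \<le> card W"
      using mult_right_mono[OF \<delta>(3), of "real (card A)"] mult_right_mono[OF \<delta>(3), of "real (card B)"] * by auto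
    ultimately have "\<bar>p_density G p U W - D\<bar> \<le> \<delta> / 2" by (intro close)
    then show "\<bar>p_density G p U W - p_density G p A B\<bar> \<le> \<epsilon>'" using whole \<delta> by linarith
  qed
  moreover have "d - \<epsilon>' \<le> p_density G p A B" using whole D \<delta> by linarith
  ultimately show ?thesis by (simp add: dense_regular_pair_def)
qed

theorem lemma4:
  fixes \<epsilon>' d :: real
  assumes "\<epsilon>' > 0" and "d > 0"
  shows "\<exists>\<epsilon> c :: real. \<epsilon> > 0 \<and> c > 0 \<and>
    (\<forall>p :: real. 0 < p \<longrightarrow> p < 1 \<longrightarrow>
      (\<forall>(\<Gamma> :: 'a pair_pre_digraph) G X Y Z.
         pair_graph \<Gamma> \<longrightarrow> pair_graph G \<longrightarrow> subgraph (with_proj G) (with_proj \<Gamma>) \<longrightarrow>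
         X \<subseteq> pverts \<Gamma> \<longrightarrow> Y \<subseteq> pverts \<Gamma> \<longrightarrow> Z \<subseteq> pverts \<Gamma> \<longrightarrow>
         X \<inter> Y = {} \<longrightarrow> X \<inter> Z = {} \<longrightarrow> Y \<inter> Z = {} \<longrightarrow>
         bijumbled \<Gamma> p (c * p ^ 2 * sqrt (real (card X) * real (card Y))) X Y \<longrightarrow>
         bijumbled \<Gamma> p (c * p ^ 3 * sqrt (real (card X) * real (card Z))) X Z \<longrightarrow>
         bijumbled \<Gamma> p
           (c * p powr (5 / 2) * log 2 (1 / p) powr (- 1 / 2) * sqrt (real (card Y) * real (card Z)))
           Y Z \<longrightarrow>
         dense_regular_pair G \<epsilon> d p Y Z \<longrightarrow>
         real (card {x \<in> X. \<not> dense_regular_pair G \<epsilon>' d p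
                               (neighbourhood \<Gamma> x \<inter> Y) (neighbourhood \<Gamma> x \<inter> Z)})
           \<le> \<epsilon>' * real (card X)))"
proof -
  \<comment> \<open>The whole pair is among its own admissible pairs of subsets only for a parameter of at most 1.\<close>
  define \<delta> where "\<delta> = min \<epsilon>' 1"
  define t where "t = (\<delta> ^ 6 / 27264)\<^sup>2"
  have \<delta>: "0 < \<delta>" "\<delta> \<le> 1" "\<delta> \<le> \<epsilon>'" using assms by (auto simp: \<delta>_def)
  have t0: "0 < t" using \<delta> by (simp add: t_def)
  have t_le: "t \<le> \<delta> / 8"
  proof -
    have a: "\<delta> ^ 6 \<le> \<delta>" using power_decreasing[of 1 6 \<delta>] \<delta> by simp
    have "t \<le> \<delta> ^ 6 / 27264"
      unfolding t_def power2_eq_square using \<delta> a by (intro mult_left_le) auto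
    then show ?thesis using a \<delta> by simp
  qed
  show ?thesis
  proof (intro exI[of _ t] conjI allI impI t0)
    fix p :: real and \<Gamma> G :: "'a pair_pre_digraph" and X Y Z
    assume p: "0 < p" "p < 1" and graphs: "pair_graph \<Gamma>" "pair_graph G"
      and sub: "subgraph (with_proj G) (with_proj \<Gamma>)"
      and YZ_disj: "Y \<inter> Z = {}"
      and XY: "bijumbled \<Gamma> p (t * p ^ 2 * sqrt (real (card X) * real (card Y))) X Y"
      and XZ: "bijumbled \<Gamma> p (t * p ^ 3 * sqrt (real (card X) * real (card Z))) X Z"
      and YZ: "bijumbled \<Gamma> p
           (t * p powr (5 / 2) * log 2 (1 / p) powr (- 1 / 2) * sqrt (real (card Y) * real (card Z))) Y Z"
      and reg: "dense_regular_pair G t d p Y Z"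
    define e where "e u v \<longleftrightarrow> (u, v) \<in> parcs \<Gamma>" for u v
    define g where "g u v \<longleftrightarrow> (u, v) \<in> parcs G" for u v
    define D where "D = p_density G p Y Z"
    define dv where "dv y z = of_bool ((y, z) \<in> parcs G) - D * p" for y z :: 'a
    have nb: "neighbourhood \<Gamma> x \<inter> B = nbrs e B x" for x B
      by (auto simp: neighbourhood_def nbrs_def e_def)
    have e_eq: "e = (\<lambda>u v. (u, v) \<in> parcs \<Gamma>)" by (simp add: e_def fun_eq_iff)
    interpret XY: jumbled_pair e p "t * p ^ 2 * sqrt (real (card X) * real (card Y))" X Y
      unfolding e_eq using graphs XY p t0 by (intro jumbled_pair_if_bijumbled) auto
    interpret XZ: jumbled_pair e p "t * p ^ 3 * sqrt (real (card X) * real (card Z))" X Z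
      unfolding e_eq using graphs XZ p t0 by (intro jumbled_pair_if_bijumbled) auto
    have verts: "Y \<subseteq> pverts G" "Z \<subseteq> pverts G" and nonempty: "Y \<noteq> {}" "Z \<noteq> {}" and D: "d - t \<le> D"
      using reg by (auto simp: dense_regular_pair_def regular_pair_def D_def)
    have regular: "\<bar>\<Sum>y\<in>S. \<Sum>z\<in>T. dv y z\<bar> \<le> t * p * card S * card T"
      if "S \<subseteq> Y" "T \<subseteq> Z" "t * card Y \<le> card S" "t * card Z \<le> card T" for S T
    proof (cases "S = {} \<or> T = {}")
      case False
      have "finite S" "finite T" using that XY.finite_V XZ.finite_V finite_subset by auto
      moreover have "\<bar>p_density G p S T - D\<bar> \<le> t"
        using reg that by (auto simp: dense_regular_pair_def regular_pair_def D_def)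
      ultimately show ?thesis
        using False p by (simp add: p_density_deviation_le_iff dv_def)
    qed auto

    \<comment> \<open>The exceptional vertices: those of low degree into Y or Z, and those in whose neighbourhoods G deviates.\<close>
    define LY where "LY = {x \<in> X. card (nbrs e Y x) < p / 2 * card Y}"
    define LZ where "LZ = {x \<in> X. card (nbrs e Z x) < p / 2 * card Z}"
    define B where "B = {x \<in> X. p / 2 * card Y \<le> card (nbrs e Y x) \<and> p / 2 * card Z \<le> card (nbrs e Z x)
           \<and> \<not> small_deviation dv p \<delta> (nbrs e Y x) (nbrs e Z x)}"
    have p_pow: "p\<^sup>2 \<le> p" "p ^ 3 \<le> p"
      using p power_decreasing[of 1 2 p] power_decreasing[of 1 3 p] by simp_all
    have "4 * t\<^sup>2 * card X \<le> \<delta> / 4 * card X"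
    proof (rule mult_right_mono)
      have "t * t \<le> (\<delta> / 8) * (1 / 8)" using t_le t0 \<delta> by (intro mult_mono) auto
      then show "4 * t\<^sup>2 \<le> \<delta> / 4" using \<delta> by (simp add: power2_eq_square)
    qed simp
    moreover have "card LY \<le> 4 * t\<^sup>2 * card X"
      unfolding LY_def using nonempty p_pow t0
      by (intro XY.card_low_degree_le mult_right_mono mult_left_mono) auto
    moreover have "card LZ \<le> 4 * t\<^sup>2 * card X"
      unfolding LZ_def using nonempty p_pow t0
      by (intro XZ.card_low_degree_le mult_right_mono mult_left_mono) auto
    moreover have "card B \<le> \<delta> / 2 * card X"
    proof (cases "p \<le> 1/4")
      case False
      have "B = {}"
        using False \<delta> t_le unfolding B_def
        by (auto intro!: small_deviation_slice[OF regular] simp: nbrs_def)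
      then show ?thesis using \<delta> by simp
    next
      case True
      let ?\<gamma> = "t * p powr (5 / 2) * sqrt (real (card Y) * real (card Z))"
      \<comment> \<open>The logarithmic factor in the bound for (Y, Z) is at most 1 in this range of p.\<close>
      have "1 \<le> log 2 (1 / p)"
        using True p by (subst le_log_iff) (auto simp: field_simps)
      then have "log 2 (1 / p) powr (- 1 / 2) \<le> 1"
        using powr_mono[of "- 1 / 2" 0 "log 2 (1 / p)"] by simp
      then have "t * p powr (5 / 2) * log 2 (1 / p) powr (- 1 / 2) * sqrt (real (card Y) * real (card Z))
          \<le> t * p powr (5 / 2) * 1 * sqrt (real (card Y) * real (card Z))"
        using t0 by (intro mult_right_mono mult_left_mono) auto
      then have YZj: "jumbled_pair e p ?\<gamma> Y Z"
        unfolding e_eq using graphs YZ p t0 by (intro jumbled_pair_if_bijumbled[OF _ YZ]) auto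
      have YZs: "strongly_jumbled_pair e p ?\<gamma> Y Z"
      proof (intro strongly_jumbled_pair.intro strongly_jumbled_pair_axioms.intro YZj True)
        have "(p powr (5 / 2))\<^sup>2 = p ^ 5" using p(1) by (rule powr_five_halves_square)
        also have "\<dots> \<le> p ^ 4" using p by (intro power_decreasing) auto
        finally have "t\<^sup>2 * (p powr (5 / 2))\<^sup>2 \<le> 1 * p ^ 4"
          using t0 t_le \<delta> by (intro mult_mono) (auto simp: power_le_one)
        then have "t\<^sup>2 * (p powr (5 / 2))\<^sup>2 * (card Y * card Z) \<le> 1 * p ^ 4 * (card Y * card Z)"
          by (intro mult_right_mono) auto
        then show "?\<gamma>\<^sup>2 \<le> p ^ 4 * card Y * card Z" by (simp add: power_mult_distrib mult_ac)
      qed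
      interpret YZ: strongly_jumbled_pair e p ?\<gamma> Y Z by (rule YZs)
      have "g y z \<Longrightarrow> e y z" for y z
        using sub by (auto simp: g_def e_def subgraph_def)
      moreover have "0 \<le> D * p" using p by (simp add: D_def p_density_def)
      moreover have "D * p \<le> 2 * p"
      proof -
        have yz: "real (card Y) > 0" "real (card Z) > 0"
          using nonempty YZ.finite_U YZ.finite_V by (auto simp: card_gt_0_iff)
        have "real (edges_between G Y Z) \<le> (\<Sum>y\<in>Y. real (card (nbrs e Z y)))"
          unfolding edges_between_eq_sum[OF YZ.finite_U YZ.finite_V] card_nbrs_eq_sum[OF YZ.finite_V]
          using calculation(1) by (intro sum_mono) (auto simp: g_def)
        also have "\<dots> \<le> 2 * p * card Y * card Z" by (rule YZ.degree_sum_le)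
        finally have "D \<le> 2" using yz p by (simp add: D_def p_density_def pos_divide_le_eq mult_ac)
        then show ?thesis using p by simp
      qed
      ultimately have "jumbled_subgraph e p ?\<gamma> Y Z g (D * p)"
        by (intro jumbled_subgraph.intro jumbled_subgraph_axioms.intro YZs)
      then interpret S: jumbled_subgraph e p ?\<gamma> Y Z g "D * p" .
      have dev: "S.dev = dv" by (simp add: fun_eq_iff S.dev_def dv_def g_def)
      show ?thesis
        unfolding B_def
        using S.card_large_deviation_le[OF XY.jumbled_pair_axioms XZ.jumbled_pair_axioms order_refl order_refl order_refl
            nonempty _ \<delta>(1,2) t_def] regular
        by (simp add: dev)
    qed
    moreover have "card {x \<in> X. \<not> dense_regular_pair G \<epsilon>' d p (neighbourhood \<Gamma> x \<inter> Y) (neighbourhood \<Gamma> x \<inter> Z)}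
        \<le> card (LY \<union> LZ \<union> B)"
    proof (rule card_mono)
      show "finite (LY \<union> LZ \<union> B)" using XY.finite_U by (simp add: LY_def LZ_def B_def)
      show "{x \<in> X. \<not> dense_regular_pair G \<epsilon>' d p (neighbourhood \<Gamma> x \<inter> Y) (neighbourhood \<Gamma> x \<inter> Z)} \<subseteq> LY \<union> LZ \<union> B"
      proof (rule ccontr)
        assume "\<not> ?thesis"
        then obtain x where x: "x \<in> X" "x \<notin> LY" "x \<notin> LZ" "x \<notin> B"
          and bad: "\<not> dense_regular_pair G \<epsilon>' d p (nbrs e Y x) (nbrs e Z x)"
          unfolding nb by auto
        have large: "p / 2 * card Y \<le> card (nbrs e Y x)" "p / 2 * card Z \<le> card (nbrs e Z x)"
          and small: "small_deviation dv p \<delta> (nbrs e Y x) (nbrs e Z x)"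
          using x by (auto simp: LY_def LZ_def B_def)
        have "p / 2 * card Y > 0" "p / 2 * card Z > 0"
          using p nonempty XY.finite_V XZ.finite_V by (auto simp: card_gt_0_iff)
        then have "nbrs e Y x \<noteq> {}" "nbrs e Z x \<noteq> {}" using large by auto
        moreover have "nbrs e Y x \<subseteq> pverts G" "nbrs e Z x \<subseteq> pverts G" "nbrs e Y x \<inter> nbrs e Z x = {}"
          using verts YZ_disj by (auto simp: nbrs_def)
        ultimately have "dense_regular_pair G \<epsilon>' d p (nbrs e Y x) (nbrs e Z x)"
          using small XY.finite_V XZ.finite_V p \<delta> D t_le unfolding dv_def
          by (intro dense_regular_pair_if_small_deviation[where D = D and \<delta> = \<delta>]) auto
        with bad show False by simp
      qed
    qed
    moreover have "card (LY \<union> LZ \<union> B) \<le> card LY + card LZ + card B"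
      using card_Un_le[of "LY \<union> LZ" B] card_Un_le[of LY LZ] by linarith
    ultimately have "real (card {x \<in> X. \<not> dense_regular_pair G \<epsilon>' d p (neighbourhood \<Gamma> x \<inter> Y) (neighbourhood \<Gamma> x \<inter> Z)})
        \<le> \<delta> * card X" by linarith
    also have "\<dots> \<le> \<epsilon>' * card X" using \<delta> by (intro mult_right_mono) auto
    finally show "real (card {x \<in> X. \<not> dense_regular_pair G \<epsilon>' d p (neighbourhood \<Gamma> x \<inter> Y) (neighbourhood \<Gamma> x \<inter> Z)})
        \<le> \<epsilon>' * real (card X)" .
  qed
qed

end
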